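(* For every cake-division instance with $n$ agents whose social graph is a tree, there exists a discrete cake-cutting protocol in the Robertson–Webb query model that computes a locally envy-free allocation using at most $n^{(1+o(1))n}$ queries.
   Context: The cake is $[0,1]$. Each agent $a_i$ has a valuation $v_i$ on finite unions of subintervals of $[0,1]$ that is non-negative, additive on disjoint pieces, non-atomic (for any $[x,y]$ and $\lambda\in[0,1]$ there is $y'$ with $v_i(x,y')=\lambda v_i(x,y)$), and normalized ($v_i(0,1)=1$). An allocation is a collection $\{A_1,\dots,A_n\}$ of pairwise disjoint pieces (each a finite union of intervals) whose union is $[0,1]$, with $A_i$ given to $a_i$. Given an undirected social graph $G$ on the agents, an allocation is locally envy-free if $v_i(A_i)\ge v_i(A_j)$ for every edge $(i,j)$ of $G$. In the Robertson–Webb query model the protocol accesses valuations only through cut queries $\texttt{cut}_i(x,\tau)$ (returns $y$ with $v_i(x,y)=\tau$) and evaluation queries $\texttt{eval}_i(x,y)$ (returns $v_i(x,y)$); the query complexity counts these queries. *)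

theory Defs
  imports "HOL-Analysis.Analysis"
begin

definition piece :: "real set \<Rightarrow> bool" where
  "piece S \<longleftrightarrow> S \<subseteq> {0..1} \<and>
     (\<exists>F. finite F \<and> (\<forall>I\<in>F. is_interval I) \<and> S = \<Union>F)"

definition valuation :: "(real set \<Rightarrow> real) \<Rightarrow> bool" where
  "valuation v \<longleftrightarrow>
     (\<forall>S. piece S \<longrightarrow> v S \<ge> 0) \<and>
     (\<forall>S T. piece S \<longrightarrow> piece T \<longrightarrow> S \<inter> T = {} \<longrightarrow> v (S \<union> T) = v S + v T) \<and>
     (\<forall>x y lam. 0 \<le> x \<longrightarrow> x \<le> y \<longrightarrow> y \<le> 1 \<longrightarrow> 0 \<le> lam \<longrightarrow> lam \<le> 1 \<longrightarrow>
        (\<exists>y'. x \<le> y' \<and> y' \<le> y \<and> v {x..y'} = lam * v {x..y})) \<and>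
     v {0..1} = 1"

definition allocation :: "nat \<Rightarrow> (nat \<Rightarrow> real set) \<Rightarrow> bool" where
  "allocation n A \<longleftrightarrow>
     (\<forall>i<n. piece (A i)) \<and>
     (\<forall>i<n. \<forall>j<n. i \<noteq> j \<longrightarrow> A i \<inter> A j = {}) \<and>
     (\<Union>i<n. A i) = {0..1}"

definition locally_envy_free ::
    "nat \<Rightarrow> (nat \<Rightarrow> nat \<Rightarrow> bool) \<Rightarrow> (nat \<Rightarrow> real set \<Rightarrow> real) \<Rightarrow> (nat \<Rightarrow> real set) \<Rightarrow> bool" where
  "locally_envy_free n E v A \<longleftrightarrow>
     (\<forall>i<n. \<forall>j<n. E i j \<longrightarrow> v i (A i) \<ge> v i (A j))"

definition is_tree :: "nat \<Rightarrow> (nat \<Rightarrow> nat \<Rightarrow> bool) \<Rightarrow> bool" where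
  "is_tree n E \<longleftrightarrow>
     n \<ge> 1 \<and>
     (\<forall>i j. E i j \<longrightarrow> i < n \<and> j < n \<and> i \<noteq> j \<and> E j i) \<and>
     (\<forall>i<n. \<forall>j<n. E\<^sup>*\<^sup>* i j) \<and>
     card {(i, j). E i j \<and> i < j} = n - 1"

text \<open>Robertson--Webb protocols as (deterministic, adaptive) query trees.
  Eval i x y k: ask eval_i(x,y), continue with k applied to the answer.
  Cut i x tau k: ask cut_i(x,tau), continue with k applied to the answer.\<close>

datatype protocol =
    Output "nat \<Rightarrow> real set"
  | Eval nat real real "real \<Rightarrow> protocol"
  | Cut nat real real "real \<Rightarrow> protocol"

text \<open>Admissible answers to cut_i(x,tau): any y \<ge> x with v(x,y) = tau; if no such
  y exists, the oracle may answer arbitrarily (adversarially).\<close>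

definition cut_answer :: "(real set \<Rightarrow> real) \<Rightarrow> real \<Rightarrow> real \<Rightarrow> real \<Rightarrow> bool" where
  "cut_answer w x tau y \<longleftrightarrow>
     (x \<le> y \<and> y \<le> 1 \<and> w {x..y} = tau) \<or>
     (\<not> (\<exists>z. x \<le> z \<and> z \<le> 1 \<and> w {x..z} = tau))"

inductive runs :: "(nat \<Rightarrow> real set \<Rightarrow> real) \<Rightarrow> protocol \<Rightarrow> (nat \<Rightarrow> real set) \<Rightarrow> nat \<Rightarrow> bool"
  for v where
  run_output: "runs v (Output A) A 0"
| run_eval: "runs v (k (v i {x..y})) A q \<Longrightarrow> runs v (Eval i x y k) A (Suc q)"
| run_cut: "cut_answer (v i) x tau y \<Longrightarrow> runs v (k y) A q \<Longrightarrow> runs v (Cut i x tau k) A (Suc q)"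

end

theory Submission
  imports Defs "HOL-Library.Function_Algebras" "HOL-Library.Multiset" "HOL-Real_Asymp.Real_Asymp"
begin

text \<open>
Give every vertex \<open>y\<close> of a tree a weight \<open>w y\<close> and ask for \<open>w y\<close> parts per vertex, equal for \<open>y\<close>, such
that \<open>y\<close> weakly prefers each of its own parts to each part of each neighbour. Such divisions are built by
adding leaves. To attach a leaf \<open>z\<close> to \<open>x\<close>, divide the cake for the smaller tree with weight
\<open>w x + w z\<close> at \<open>x\<close>, let \<open>z\<close> take its favourite \<open>w z\<close> of the parts of \<open>x\<close> and trim them to equal value,
and divide the trimmings again in the same way. Distributing the parts of successive rounds so that each slot
of \<open>z\<close> once receives the part that was trimmed most in the view of \<open>x\<close>, after \<open>w z\<close> rounds \<open>x\<close> has an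
advantage over every slot of at least a fraction \<open>1 / w z\<close> of the residue. Each further round shrinks the
residue, as valued by \<open>x\<close>, by a factor \<open>1 - 1 / n\<close>, so after another \<open>n \<lceil>ln n\<rceil>\<close> rounds \<open>x\<close> does not mind if
\<open>z\<close> gets all of it. Each leaf thus multiplies the cost by about \<open>n ln n\<close>. Starting from a single vertex of
weight \<open>n\<close> and ending with all weights 1 costs \<open>n ^ n * (ln n) ^ O(n)\<close> cuts.
\<close>

section \<open>Splitting game on value profiles\<close>

text \<open>Profiles are added as functions. Pointwise evaluation is unfolded only on request, so
  that sums of profiles remain terms that \<open>ac_simps\<close> can rearrange.\<close>

declare plus_fun_apply [simp del] zero_fun_apply [simp del] add_mset_commute [ac_simps]

type_synonym profile = "nat \<Rightarrow> real"

text \<open>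
A piece is represented only by its value for each agent, the cake by the multiset of its pieces.
A split by agent \<open>i\<close> costs one unit; how the other agents value the two parts is up to an adversary.
\<close>

inductive can_reach :: "nat \<Rightarrow> (profile multiset \<Rightarrow> bool) \<Rightarrow> nat \<Rightarrow> profile multiset \<Rightarrow> bool"
  for n :: nat and G :: "profile multiset \<Rightarrow> bool" where
  stop: "G M \<Longrightarrow> can_reach n G k M"
| merge: "can_reach n G k (M + {#u + w#}) \<Longrightarrow> can_reach n G k (M + {#u#} + {#w#})"
| split: "i < n \<Longrightarrow> 0 \<le> t \<Longrightarrow> t \<le> x i \<Longrightarrow>
    (\<And>u w. 0 \<le> u \<Longrightarrow> 0 \<le> w \<Longrightarrow> u + w = x \<Longrightarrow> u i = t \<Longrightarrow> can_reach n G k (M + {#u#} + {#w#})) \<Longrightarrow>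
    can_reach n G (Suc k) (M + {#x#})"

section \<open>Composition of strategies and invariants of the game\<close>

lemma can_mono: "can_reach n G k M \<Longrightarrow> k \<le> k' \<Longrightarrow> can_reach n G k' M"
proof (induction arbitrary: k' rule: can_reach.induct)
  case (split i t x k M)
  then obtain k'' where "k' = Suc k''" "k \<le> k''" by (cases k') auto
  have "can_reach n G (Suc k'') (M + {#x#})"
    by (rule can_reach.split[where i = i and t = t and x = x, OF split(1-3)]) (use split.IH \<open>k \<le> k''\<close> in blast)
  then show ?case using \<open>k' = Suc k''\<close> by simp
next
  case (merge k M u w)
  show ?case by (rule can_reach.merge) (rule merge.IH[OF merge.prems])
qed (auto intro: can_reach.stop)

text \<open>Composition and framing in one: the moves towards \<open>G\<close> ignore
  \<open>N\<close>, and the second strategy may depend on the outcome \<open>M'\<close> that the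
  adversary allowed. Budgets add.\<close>

lemma can_seq:
  assumes "can_reach n G k M" "\<And>M'. G M' \<Longrightarrow> can_reach n H k' (M' + N)"
  shows "can_reach n H (k + k') (M + N)"
  using assms(1)
proof (induction rule: can_reach.induct)
  case (stop M k)
  then show ?case using assms(2) can_mono by (metis le_add2)
next
  case (merge k M u w)
  then have "can_reach n H (k + k') ((M + N) + {#u + w#})" by (simp add: ac_simps)
  from can_reach.merge[OF this] show ?case by (simp add: ac_simps)
next
  case (split i t x k M)
  have "can_reach n H (Suc (k + k')) ((M + N) + {#x#})"
  proof (rule can_reach.split[where i = i and t = t and x = x, OF split(1-3)])
    fix u w :: profile assume "0 \<le> u" "0 \<le> w" "u + w = x" "u i = t"
    from split(5)[OF this] show "can_reach n H (k + k') (M + N + {#u#} + {#w#})"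
      by (simp add: ac_simps)
  qed
  then show ?case by (simp add: ac_simps)
qed

text \<open>Every move preserves nonnegativity and the total, so both can be added to a goal
  afterwards instead of being carried through each strategy.\<close>

lemma can_inv:
  assumes "can_reach n G k M" "\<forall>u\<in>#M. 0 \<le> u"
  shows "can_reach n (\<lambda>M'. G M' \<and> (\<forall>u\<in>#M'. 0 \<le> u) \<and> sum_mset M' = sum_mset M) k M"
  using assms
proof (induction rule: can_reach.induct)
  case (stop M k)
  then show ?case by (auto intro: can_reach.stop)
next
  case (merge k M u w)
  have "\<forall>a\<in>#M + {#u + w#}. 0 \<le> a"
    using merge.prems by (auto simp: le_fun_def plus_fun_apply zero_fun_apply)
  with merge.IH have
    "can_reach n (\<lambda>M'. G M' \<and> (\<forall>u\<in>#M'. 0 \<le> u) \<and> sum_mset M' = sum_mset (M + {#u + w#})) k (M + {#u + w#})"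
    by blast
  from can_reach.merge[OF this] show ?case by (simp add: ac_simps)
next
  case (split i t x k M)
  show ?case
  proof (rule can_reach.split[where i = i and t = t and x = x, OF split(1-3)])
    fix u w :: profile assume a: "0 \<le> u" "0 \<le> w" "u + w = x" "u i = t"
    have "\<forall>a\<in>#M + {#u#} + {#w#}. 0 \<le> a" using split.prems a by auto
    from split.IH[OF a this]
    show "can_reach n (\<lambda>M'. G M' \<and> (\<forall>u\<in>#M'. 0 \<le> u) \<and> sum_mset M' = sum_mset (M + {#x#})) k (M + {#u#} + {#w#})"
      unfolding a(3)[symmetric] by (simp add: ac_simps)
  qed
qed

lemma can_merge_list:
  "ws \<noteq> [] \<Longrightarrow> can_reach n G k (M + {#sum_list ws#}) \<Longrightarrow> can_reach n G k (M + mset ws)"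
proof (induction ws arbitrary: M)
  case (Cons w ws)
  show ?case
  proof (cases "ws = []")
    case True
    then show ?thesis using Cons.prems by simp
  next
    case False
    have "can_reach n G k (M + {#w + sum_list ws#})" using Cons.prems by simp
    from can_reach.merge[OF this] Cons.IH[OF False, of "M + {#w#}"]
    show ?thesis by (simp add: ac_simps)
  qed
qed simp

lemma can_merge_zip:
  "length xs = length ys \<Longrightarrow> can_reach n G k (M + mset (map2 (+) xs ys)) \<Longrightarrow> can_reach n G k (M + mset xs + mset ys)"
proof (induction xs ys arbitrary: M rule: list_induct2)
  case (Cons x xs y ys)
  have "can_reach n G k ((M + mset (map2 (+) xs ys)) + {#x + y#})" using Cons.prems by (simp add: ac_simps)
  from can_reach.merge[OF this] have "can_reach n G k ((M + {#x#} + {#y#}) + mset (map2 (+) xs ys))"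
    by (simp add: ac_simps)
  from Cons.IH[OF this] show ?case by (simp add: ac_simps)
qed simp

lemma can_merge_sum:
  assumes "finite V" "\<forall>y\<in>V. length (Y y) = length (Z y)"
    "can_reach n G k (M + (\<Sum>y\<in>V. mset (map2 (+) (Y y) (Z y))))"
  shows "can_reach n G k (M + (\<Sum>y\<in>V. mset (Y y)) + (\<Sum>y\<in>V. mset (Z y)))"
  using assms
proof (induction V arbitrary: M rule: finite_induct)
  case (insert v V)
  have "can_reach n G k ((M + mset (map2 (+) (Y v) (Z v))) + (\<Sum>y\<in>V. mset (map2 (+) (Y y) (Z y))))"
    using insert by (simp add: ac_simps)
  then have "can_reach n G k ((M + mset (map2 (+) (Y v) (Z v))) + (\<Sum>y\<in>V. mset (Y y)) + (\<Sum>y\<in>V. mset (Z y)))"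
    using insert by blast
  then have "can_reach n G k ((M + (\<Sum>y\<in>V. mset (Y y)) + (\<Sum>y\<in>V. mset (Z y))) + mset (map2 (+) (Y v) (Z v)))"
    by (simp add: ac_simps)
  from can_merge_zip[OF _ this] insert.prems insert.hyps show ?case by (simp add: ac_simps)
qed simp

section \<open>Trimming and equal division by one agent\<close>

text \<open>In each pair of \<open>us\<close> the first component is the part kept and the second
  the trimming. The frame \<open>N\<close> belongs to the statement because the induction moves
  finished cuts into it.\<close>

lemma can_trim:
  assumes "z < n" "0 \<le> \<beta>" "\<forall>p\<in>set ps. \<beta> \<le> p z"
  shows "can_reach n (\<lambda>M. \<exists>us. M = mset (map fst us) + mset (map snd us) + N \<and> length us = length ps \<and>
     (\<forall>l<length ps. 0 \<le> fst (us!l) \<and> 0 \<le> snd (us!l) \<and> fst (us!l) + snd (us!l) = ps!l \<and> fst (us!l) z = \<beta>))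
     (length ps) (mset ps + N)"
  using assms(3)
proof (induction ps arbitrary: N)
  case Nil
  then show ?case by (auto intro: can_reach.stop)
next
  case (Cons p ps)
  have "can_reach n (\<lambda>M. \<exists>us. M = mset (map fst us) + mset (map snd us) + N \<and> length us = length (p # ps) \<and>
     (\<forall>l<length (p # ps). 0 \<le> fst (us!l) \<and> 0 \<le> snd (us!l) \<and> fst (us!l) + snd (us!l) = (p # ps)!l \<and> fst (us!l) z = \<beta>))
     (Suc (length ps)) ((mset ps + N) + {#p#})" (is "can_reach n ?H _ _")
  proof (rule can_reach.split[where i = z and t = \<beta> and x = p, OF assms(1,2)])
    show "\<beta> \<le> p z" using Cons.prems by simp
    fix u w :: profile assume a: "0 \<le> u" "0 \<le> w" "u + w = p" "u z = \<beta>"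
    have "can_reach n ?H (length ps + 0) ((mset ps + (N + {#u#} + {#w#})) + {#})"
    proof (rule can_seq[OF Cons.IH], goal_cases)
      case 1
      then show ?case using Cons.prems by simp
    next
      case (2 M')
      then obtain us where us: "M' = mset (map fst us) + mset (map snd us) + (N + {#u#} + {#w#})"
        "length us = length ps" 
        "\<forall>l<length ps. 0 \<le> fst (us!l) \<and> 0 \<le> snd (us!l) \<and> fst (us!l) + snd (us!l) = ps!l \<and> fst (us!l) z = \<beta>"
        by blast
      have "?H M'"
        using us a by (intro exI[of _ "(u, w) # us"]) (auto simp: nth_Cons split: nat.split)
      then show ?case by (auto intro: can_reach.stop)
    qed
    then show "can_reach n ?H (length ps) (mset ps + N + {#u#} + {#w#})" by (simp add: ac_simps)
  qed
  then show ?case by (simp add: ac_simps)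
qed

text \<open>One share of value \<open>c\<close> is cut off at a time and the last share is what
  remains. The bound \<open>p \<le> X\<close> limits what any other agent sees in a share; it
  controls \<open>x\<close> when \<open>z\<close> divides the residue.\<close>

lemma can_equal:
  assumes "z < n" "0 \<le> c" "0 \<le> X" "X z = real (Suc b) * c"
  shows "can_reach n (\<lambda>M. \<exists>ps. M = mset ps + N \<and> length ps = Suc b \<and> (\<forall>p\<in>set ps. 0 \<le> p \<and> p \<le> X \<and> p z = c)) b ({#X#} + N)"
  using assms(3-)
proof (induction b arbitrary: X N)
  case 0
  then show ?case by (intro can_reach.stop exI[of _ "[X]"]) auto
next
  case (Suc b)
  have "can_reach n (\<lambda>M. \<exists>ps. M = mset ps + N \<and> length ps = Suc (Suc b) \<and> (\<forall>p\<in>set ps. 0 \<le> p \<and> p \<le> X \<and> p z = c))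
     (Suc b) (N + {#X#})" (is "can_reach n ?H _ _")
  proof (rule can_reach.split[where i = z and t = c and x = X, OF assms(1,2)])
    show "c \<le> X z" using Suc.prems assms(2) by (simp add: algebra_simps)
    fix u w :: profile assume a: "0 \<le> u" "0 \<le> w" "u + w = X" "u z = c"
    have wz: "w z = real (Suc b) * c" using a Suc.prems(2) by (auto simp: algebra_simps plus_fun_apply)
    have le: "w \<le> X" "u \<le> X" using a by (auto simp: le_fun_def plus_fun_apply zero_fun_apply)
    have "can_reach n ?H (b + 0) (({#w#} + (N + {#u#})) + {#})"
    proof (rule can_seq[OF Suc.IH[OF a(2) wz]], goal_cases)
      case (1 M')
      then obtain ps where "M' = mset ps + (N + {#u#})" "length ps = Suc b"
        "\<forall>p\<in>set ps. 0 \<le> p \<and> p \<le> w \<and> p z = c" by blast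
      then have "?H M'" using a le by (intro exI[of _ "u # ps"]) (auto intro: order_trans)
      then show ?case by (auto intro: can_reach.stop)
    qed
    then show "can_reach n ?H b (N + {#u#} + {#w#})" by (simp add: ac_simps)
  qed
  then show ?case by (simp add: ac_simps)
qed

section \<open>Weighted divisions without envy along edges\<close>

text \<open>\<open>F\<close> consists of directed comparisons: \<open>(x, y)\<close> constrains only
  the opinion of \<open>x\<close>. As all parts are compared with all parts, the order of the lists
  is free and parts may be permuted among slots.\<close>

definition good :: "nat set \<Rightarrow> (nat \<times> nat) set \<Rightarrow> (nat \<Rightarrow> profile list) \<Rightarrow> bool" where
  "good V F Y \<longleftrightarrow> (\<forall>x\<in>V. \<forall>u\<in>set (Y x). \<forall>u'\<in>set (Y x). u x = u' x) \<and>
     (\<forall>(x, y)\<in>F. \<forall>u\<in>set (Y x). \<forall>u'\<in>set (Y y). u' x \<le> u x)"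

text \<open>Required for every nonnegative \<open>X\<close> and not only for the unit cake, since
  the same division is applied again to residues of unknown value.\<close>

definition divides_into :: "nat \<Rightarrow> nat \<Rightarrow> nat set \<Rightarrow> (nat \<times> nat) set \<Rightarrow> (nat \<Rightarrow> nat) \<Rightarrow> bool" where
  "divides_into n C V F w \<longleftrightarrow> (\<forall>X. 0 \<le> X \<longrightarrow>
     can_reach n (\<lambda>M. \<exists>Y. M = (\<Sum>y\<in>V. mset (Y y)) \<and> (\<forall>y\<in>V. length (Y y) = w y) \<and> good V F Y) C {#X#})"

lemma set_map2E:
  assumes "u \<in> set (map2 (+) xs ys)"
  obtains a b where "a \<in> set xs" "b \<in> set ys" "u = a + b"
  using assms by (auto dest: set_zip_leftD set_zip_rightD)

text \<open>Both conditions are additive in the profiles and hold for all pairs of parts, so two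
  divisions can be joined slot by slot under any matching of slots. This lets rounds
  accumulate.\<close>

lemma good_add:
  assumes "good V F Y" "good V F Z"
  shows "good V F (\<lambda>y. map2 (+) (Y y) (Z y))"
  unfolding good_def
proof (intro conjI ballI, goal_cases)
  case (1 x u u')
  from 1(2) 1(3) obtain a b a' b' where "a \<in> set (Y x)" "b \<in> set (Z x)" "u = a + b"
    "a' \<in> set (Y x)" "b' \<in> set (Z x)" "u' = a' + b'" by (metis set_map2E)
  with assms 1(1) have "a x = a' x" "b x = b' x" unfolding good_def by blast+
  with \<open>u = _\<close> \<open>u' = _\<close> show ?case by (simp add: plus_fun_apply)
next
  case (2 e)
  obtain x y where e: "e = (x, y)" by force
  have "u' x \<le> u x" if "u \<in> set (map2 (+) (Y x) (Z x))" "u' \<in> set (map2 (+) (Y y) (Z y))" for u u'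
  proof -
    from that obtain a b a' b' where ab: "a \<in> set (Y x)" "b \<in> set (Z x)" "u = a + b"
      "a' \<in> set (Y y)" "b' \<in> set (Z y)" "u' = a' + b'" by (metis set_map2E)
    with assms 2 e have "a' x \<le> a x" "b' x \<le> b x" unfolding good_def by blast+
    with ab show ?thesis by (simp add: add_mono plus_fun_apply)
  qed
  then show ?case using e by auto
qed

lemma sum_mset_apply: "sum_mset M i = (\<Sum>u\<in>#M. u i)" for M :: "profile multiset"
  by (induction M) (auto simp: plus_fun_apply zero_fun_apply)

lemma sum_list_apply: "sum_list us i = (\<Sum>u\<leftarrow>us. u i)" for us :: "profile list"
  by (induction us) (auto simp: plus_fun_apply zero_fun_apply)

lemma sum_mset_image_nonneg: "(\<And>u. u \<in># M \<Longrightarrow> 0 \<le> f u) \<Longrightarrow> 0 \<le> (\<Sum>u\<in>#M. f u)"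
  for f :: "'a \<Rightarrow> real"
  by (induction M) (auto intro: add_nonneg_nonneg)

lemma divides_into_single:
  assumes "r < n" "w r \<ge> 1"
  shows "divides_into n (w r) {r} {} w"
  unfolding divides_into_def
proof (intro allI impI)
  fix X :: profile assume X: "0 \<le> X"
  obtain b where b: "w r = Suc b" using assms(2) by (cases "w r") auto
  have "can_reach n (\<lambda>M. \<exists>ps. M = mset ps + {#} \<and> length ps = Suc b \<and> (\<forall>p\<in>set ps. 0 \<le> p \<and> p \<le> X \<and> p r = X r / real (Suc b))) b ({#X#} + {#})"
    using X by (intro can_equal assms) (auto simp: le_fun_def zero_fun_apply simp del: of_nat_Suc)
  then have "can_reach n (\<lambda>M. \<exists>Y. M = (\<Sum>y\<in>{r}. mset (Y y)) \<and> (\<forall>y\<in>{r}. length (Y y) = w y) \<and> good {r} {} Y)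
      (b + 1) (({#X#} + {#}) + {#})" (is "can_reach n ?H _ _")
  proof (rule can_seq, goal_cases)
    case (1 M')
    then obtain ps where ps: "M' = mset ps" "length ps = Suc b" "\<forall>p\<in>set ps. p r = X r / real (Suc b)"
      by auto
    then have "\<forall>u\<in>set ps. \<forall>u'\<in>set ps. u r = u' r" by metis
    then have "?H M'" using b ps by (intro exI[of _ "\<lambda>_. ps"]) (simp add: good_def)
    then show ?case by (auto intro: can_reach.stop)
  qed
  then show "can_reach n ?H (w r) {#X#}" by (simp add: b)
qed

section \<open>Attaching a leaf\<close>

text \<open>All \<open>w x + w z\<close> parts are equal for \<open>x\<close>, so it envies no
  trimmed one; \<open>z\<close> trims its favourites only down to the least of them, so it envies no
  untouched one. Each of the \<open>w z\<close> trimmings is at most one such equal part, which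
  bounds the residue, and the largest is at least the average \<open>R x / w z\<close>, which is the
  advantage over slot \<open>l0\<close>.\<close>

lemma attach_round:
  assumes div: "divides_into n C V F (w(x := w x + w z))"
    and V: "finite V" "x \<in> V" "z \<notin> V" "z < n" "F \<subseteq> V \<times> V"
    and w: "w x \<ge> 1" "l0 < w z" and X: "0 \<le> X"
  shows "can_reach n (\<lambda>M. \<exists>Y R. M = (\<Sum>y\<in>insert z V. mset (Y y)) + {#R#} \<and> 0 \<le> R \<and>
     (\<forall>y\<in>insert z V. length (Y y) = w y) \<and> good (insert z V) (F \<union> {(x, z), (z, x)}) Y \<and>
     (w x + w z) * R x \<le> w z * X x \<and> (\<forall>u\<in>set (Y x). R x \<le> w z * (u x - (Y z ! l0) x)))
     (C + w z) {#X#}" (is "can_reach n ?H _ _")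
proof -
  define b where "b = w z"
  let ?w = "w(x := w x + w z)"
  have b: "l0 < b" "b \<ge> 1" using w by (auto simp: b_def)
  have "can_reach n ?H (C + w z) ({#X#} + {#})"
  proof (rule can_seq[OF can_inv[OF div[unfolded divides_into_def, rule_format, OF X]]], goal_cases)
    case 1
    then show ?case using X by simp
  next
    case (2 M')
    then obtain P where M': "M' = (\<Sum>y\<in>V. mset (P y))" and len: "\<And>y. y \<in> V \<Longrightarrow> length (P y) = ?w y"
      and good: "good V F P" and nonneg: "\<forall>u\<in>#M'. 0 \<le> u" and sum: "sum_mset M' = X" by auto
    \<comment> \<open>Negating the key sorts by decreasing value for \<open>z\<close>:
      \<open>T\<close> will be its \<open>b\<close> favourites and \<open>D\<close> the parts left
      to \<open>x\<close>.\<close>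
    define S where "S = sort_key (\<lambda>u. - u z) (P x)"
    define M0 where "M0 = (\<Sum>y\<in>V - {x}. mset (P y))"
    have mS: "mset S = mset (P x)" and setS: "set S = set (P x)" and lenS: "length S = w x + b"
      using len[OF V(2)] by (auto simp: S_def b_def)
    have M'_eq: "M' = M0 + mset S"
      using V by (simp add: M' M0_def mS sum.remove[of V x] ac_simps)
    define T where "T = take b S"
    define D where "D = drop b S"
    have TD: "S = T @ D" by (simp add: T_def D_def)
    have lenT: "length T = b" "length D = w x" using lenS by (auto simp: T_def D_def)
    \<comment> \<open>The value of the least favourite: no part in \<open>T\<close> is worth less to
      \<open>z\<close> and none in \<open>D\<close> more.\<close>
    define \<beta> where "\<beta> = last T z"
    have T0: "T \<noteq> []" using lenT b by auto
    have sorted: "sorted_wrt (\<lambda>u v. v z \<le> u z) S"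
      using sorted_sort_key[of "\<lambda>u. - u z" "P x"] by (simp add: S_def sorted_map)
    have T\<beta>: "\<forall>p\<in>set T. \<beta> \<le> p z" and D\<beta>: "\<forall>p\<in>set D. p z \<le> \<beta>"
    proof -
      have "sorted_wrt (\<lambda>u v. v z \<le> u z) (T @ D)" using sorted TD by simp
      then have 1: "sorted_wrt (\<lambda>u v. v z \<le> u z) T" and "\<forall>u\<in>set T. \<forall>v\<in>set D. v z \<le> u z"
        by (auto simp: sorted_wrt_append)
      then show "\<forall>p\<in>set D. p z \<le> \<beta>" using T0 by (auto simp: \<beta>_def)
      have "sorted_wrt (\<lambda>u v. v z \<le> u z) (butlast T @ [last T])" using 1 T0 by simp
      then have "\<forall>p\<in>set (butlast T @ [last T]). \<beta> \<le> p z" by (auto simp: sorted_wrt_append \<beta>_def)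
      then show "\<forall>p\<in>set T. \<beta> \<le> p z" using T0 by simp
    qed
    have nonS: "\<forall>u\<in>set S. 0 \<le> u" using nonneg by (auto simp: M'_eq)
    have \<beta>0: "0 \<le> \<beta>" using nonS T0 TD by (auto simp: \<beta>_def le_fun_def zero_fun_apply)
    obtain u0 where u0: "u0 \<in> set S" using T0 TD by (cases T) auto
    define \<pi> where "\<pi> = u0 x"
    have eqS: "u x = \<pi>" if "u \<in> set S" for u
      using good that u0 V(2) unfolding \<pi>_def setS good_def by blast
    \<comment> \<open>The parts of \<open>x\<close> are summands of \<open>X\<close>, each worth
      \<pi> to \<open>x\<close>, and the others in \<open>M0\<close> are nonnegative. Here the total
      supplied by \<open>can_inv\<close> enters.\<close>
    have \<pi>X: "(w x + b) * \<pi> \<le> X x"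
    proof -
      have "X x = (\<Sum>u\<in>#M0. u x) + (\<Sum>u\<leftarrow>S. u x)"
        unfolding sum[symmetric] sum_mset_apply by (simp add: M'_eq flip: sum_mset_sum_list)
      moreover have "(\<Sum>u\<leftarrow>S. u x) = (w x + b) * \<pi>"
    proof -
      have e: "map (\<lambda>u. u x) S = map (\<lambda>_. \<pi>) S" using eqS by (intro map_cong) auto
      show ?thesis unfolding e by (simp add: sum_list_triv lenS)
    qed
      moreover have "0 \<le> (\<Sum>u\<in>#M0. u x)"
        using nonneg by (intro sum_mset_image_nonneg) (auto simp: M'_eq le_fun_def zero_fun_apply)
      ultimately show ?thesis by simp
    qed
    have "can_reach n ?H (length T + 0) ((mset T + (M0 + mset D)) + {#})"
    proof (rule can_seq[OF can_trim[OF V(4) \<beta>0 T\<beta>]], goal_cases)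
      case (1 M'')
      then obtain us where M'': "M'' = mset (map fst us) + mset (map snd us) + (M0 + mset D)" and lenu: "length us = b"
        and us: "\<And>l. l < b \<Longrightarrow> 0 \<le> fst (us!l) \<and> 0 \<le> snd (us!l) \<and> fst (us!l) + snd (us!l) = T!l \<and> fst (us!l) z = \<beta>"
        using lenT by auto
      have us': "0 \<le> fst e" "0 \<le> snd e" "fst e z = \<beta>" "fst e x + snd e x = \<pi>" if "e \<in> set us" for e
      proof -
        from that obtain l where l: "l < b" "e = us ! l" using lenu by (auto simp: in_set_conv_nth)
        have "T ! l \<in> set S" using l lenT by (simp add: TD)
        then have "(T ! l) x = \<pi>" by (rule eqS)
        with us[OF l(1)] l show "0 \<le> fst e" "0 \<le> snd e" "fst e z = \<beta>" "fst e x + snd e x = \<pi>"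
          by (auto simp flip: plus_fun_apply)
      qed
      define R where "R = sum_list (map snd us)"
      have R0: "0 \<le> R" unfolding R_def by (intro sum_list_nonneg) (auto dest: us')
      have Rx: "R x = (\<Sum>e\<leftarrow>us. snd e x)" by (simp add: R_def sum_list_apply o_def)
      have "\<exists>c<b. \<forall>l<b. snd (us!l) x \<le> snd (us!c) x"
      proof -
        let ?A = "(\<lambda>l. snd (us!l) x) ` {..<b}"
        have "Max ?A \<in> ?A" using b by (intro Max_in) auto
        then obtain c where "c < b" "Max ?A = snd (us!c) x" by auto
        moreover have "snd (us!l) x \<le> Max ?A" if "l < b" for l using that by (intro Max_ge) auto
        ultimately show ?thesis by metis
      qed
      then obtain c where c: "c < b" "\<forall>l<b. snd (us!l) x \<le> snd (us!c) x" by blast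
      \<comment> \<open>the part trimmed most in the view of \<open>x\<close> goes to slot \<open>l0\<close>\<close>
      define us2 where "us2 = us[c := us ! l0, l0 := us ! c]"
      have mus2: "mset us2 = mset us" unfolding us2_def using b c lenu by (intro mset_swap) auto
      have set2: "set us2 = set us" using mus2 by (metis set_mset_mset)
      have len2: "length us2 = b" by (simp add: us2_def lenu)
      have us2l0: "us2 ! l0 = us ! c" using b lenu by (simp add: us2_def)
      \<comment> \<open>Two bounds on the residue: by the largest trimming, for the advantage over
        slot \<open>l0\<close>, and by \<pi>, for the shrinking.\<close>
      have Rle: "R x \<le> b * snd (us ! c) x"
      proof -
        have "(\<Sum>e\<leftarrow>us. snd e x) \<le> (\<Sum>e\<leftarrow>us. snd (us!c) x)"
          using c lenu by (intro sum_list_mono) (auto simp: in_set_conv_nth)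
        then show ?thesis using lenu by (simp add: Rx sum_list_triv)
      qed
      have Rle2: "R x \<le> b * \<pi>"
      proof -
        have "(\<Sum>e\<leftarrow>us. snd e x) \<le> (\<Sum>e\<leftarrow>us. \<pi>)"
        proof (rule sum_list_mono)
          fix e assume "e \<in> set us"
          from us'[OF this] show "snd e x \<le> \<pi>" by (auto simp: le_fun_def zero_fun_apply)
        qed
        then show ?thesis using lenu by (simp add: Rx sum_list_triv)
      qed
      define Y where "Y = P(x := D, z := map fst us2)"
      have xz: "x \<noteq> z" using V by auto
      have Y: "Y x = D" "Y z = map fst us2" "\<And>y. y \<in> V - {x} \<Longrightarrow> Y y = P y"
        using V xz by (auto simp: Y_def)
      have Ysum: "(\<Sum>y\<in>insert z V. mset (Y y)) = mset (map fst us2) + mset D + M0"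
      proof -
        have "(\<Sum>y\<in>V. mset (Y y)) = mset D + M0"
          using V(1,2) Y by (simp add: sum.remove[of V x] M0_def)
        then show ?thesis using V Y by simp
      qed
      have "\<forall>y\<in>insert z V. length (Y y) = w y"
        using len xz lenT len2 by (auto simp: Y_def b_def)
      moreover have "good (insert z V) (F \<union> {(x, z), (z, x)}) Y"
      proof -
        \<comment> \<open>No vertex of \<open>V\<close> receives a part that it did not hold in
          \<open>P\<close>, so the comparisons along \<open>F\<close> are inherited.\<close>
        have sub: "set (Y y) \<subseteq> set (P y)" if "y \<in> V" for y
          using that Y V TD setS by (cases "y = x") auto
        have "u y = u' y" if "y \<in> V" "u \<in> set (Y y)" "u' \<in> set (Y y)" for y u u'
          using sub[OF that(1)] that good unfolding good_def by blast
        moreover have "u z = u' z" if h: "u \<in> set (Y z)" "u' \<in> set (Y z)" for u u'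
        proof -
          obtain e e' where "e \<in> set us" "u = fst e" "e' \<in> set us" "u' = fst e'" using h set2 by (auto simp: Y)
          then show ?thesis using us'(3) by simp
        qed
        moreover have "u' y \<le> u y" if h: "(y, y') \<in> F" "u \<in> set (Y y)" "u' \<in> set (Y y')" for y y' u u'
          using sub[of y] sub[of y'] V(5) h good unfolding good_def by blast
        moreover have "u' x \<le> u x" if h: "u \<in> set (Y x)" "u' \<in> set (Y z)" for u u'
        proof -
          have "u x = \<pi>" using h TD eqS by (auto simp: Y)
          moreover obtain e where "e \<in> set us" "u' = fst e" using h set2 by (auto simp: Y)
          moreover from this have "0 \<le> snd e x" using us'(2) by (simp add: le_fun_def zero_fun_apply)
          ultimately show ?thesis using us'(4)[of e] by simp
        qed
        moreover have "u' z \<le> u z" if h: "u \<in> set (Y z)" "u' \<in> set (Y x)" for u u'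
        proof -
          obtain e where "e \<in> set us" "u = fst e" using h set2 by (auto simp: Y)
          then show ?thesis using us'(3)[of e] D\<beta> h by (simp add: Y)
        qed
        ultimately show ?thesis unfolding good_def by auto
      qed
      moreover have "(w x + w z) * R x \<le> w z * X x"
      proof -
        have "(w x + b) * R x \<le> (w x + b) * (b * \<pi>)" using Rle2 by (intro mult_left_mono) auto
        also have "\<dots> = b * ((w x + b) * \<pi>)" by simp
        also have "\<dots> \<le> b * X x" using \<pi>X by (intro mult_left_mono) auto
        finally show ?thesis by (simp add: b_def)
      qed
      moreover have "\<forall>u\<in>set (Y x). R x \<le> w z * (u x - (Y z ! l0) x)"
      proof
        fix u assume "u \<in> set (Y x)"
        then have "u x = \<pi>" using TD eqS by (auto simp: Y)
        moreover have "(Y z ! l0) x = fst (us ! c) x" using len2 b by (simp add: Y us2l0)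
        moreover have "fst (us ! c) x + snd (us ! c) x = \<pi>" using us'[of "us ! c"] c lenu by simp
        ultimately have "u x - (Y z ! l0) x = snd (us ! c) x" by linarith
        then show "R x \<le> w z * (u x - (Y z ! l0) x)" using Rle by (simp add: b_def)
      qed
      ultimately have "?H ((\<Sum>y\<in>insert z V. mset (Y y)) + {#R#})" using R0 by blast
      then have "can_reach n ?H 0 ((\<Sum>y\<in>insert z V. mset (Y y)) + {#R#})" by (rule can_reach.stop)
      then have "can_reach n ?H 0 ((\<Sum>y\<in>insert z V. mset (Y y)) + mset (map snd us))"
        using lenu b unfolding R_def by (intro can_merge_list) auto
      moreover have "mset (map fst us2) = mset (map fst us)" using mus2 by (metis mset_map)
      ultimately show ?case by (simp only: Ysum M'' ac_simps add_0_right add_0_left)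
    qed
    then show ?case unfolding M'_eq TD b_def[symmetric] using lenT by (simp add: ac_simps)
  qed
  then show ?thesis by simp
qed

section \<open>Repeated rounds on the residue\<close>

locale attach =
  fixes n C :: nat and V :: "nat set" and F :: "(nat \<times> nat) set" and w :: "nat \<Rightarrow> nat" and x z :: nat
  assumes div: "divides_into n C V F (w(x := w x + w z))"
    and V: "finite V" "x \<in> V" "z \<notin> V" "z < n" "F \<subseteq> V \<times> V"
    and w: "w x \<ge> 1" "w z \<ge> 1" "w x + w z \<le> n"
begin

definition partial :: "(nat \<Rightarrow> profile list) \<Rightarrow> profile \<Rightarrow> bool" where
  "partial Y R \<longleftrightarrow> 0 \<le> R \<and> (\<forall>y\<in>insert z V. length (Y y) = w y) \<and>
     good (insert z V) (F \<union> {(x, z), (z, x)}) Y"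

definition state :: "(nat \<Rightarrow> profile list) \<Rightarrow> profile \<Rightarrow> profile multiset" where
  "state Y R = (\<Sum>y\<in>insert z V. mset (Y y)) + {#R#}"

text \<open>The residue is divided like a fresh cake and the outcome added slot by slot. The new
  round is itself free of envy, so no advantage of \<open>x\<close> decreases, and slot
  \<open>l0\<close> adds its own. The existential names the old part of \<open>x\<close> inside
  \<open>u'\<close>, through which bounds are carried from round to round.\<close>

lemma one_round:
  assumes "partial Y R" "l0 < w z"
  shows "can_reach n (\<lambda>M. \<exists>Y' R'. M = state Y' R' \<and> partial Y' R' \<and> R' x \<le> (1 - 1 / n) * R x \<and>
     (\<forall>l<w z. \<forall>u'\<in>set (Y' x). \<exists>u\<in>set (Y x). u x - (Y z ! l) x + (if l = l0 then R' x / w z else 0) \<le> u' x - (Y' z ! l) x))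
     (C + w z) (state Y R)" (is "can_reach n ?H _ _")
proof -
  have R: "0 \<le> R" using assms by (simp add: partial_def)
  have fin: "finite (insert z V)" using V by simp
  have "can_reach n ?H ((C + w z) + 0) ({#R#} + (\<Sum>y\<in>insert z V. mset (Y y)))"
  proof (rule can_seq[OF attach_round[OF div V w(1) assms(2) R]], goal_cases)
    case (1 M)
    then obtain Z :: "nat \<Rightarrow> profile list" and R' :: profile where M: "M = (\<Sum>y\<in>insert z V. mset (Z y)) + {#R'#}" and R': "0 \<le> R'"
      and len: "\<forall>y\<in>insert z V. length (Z y) = w y"
      and good: "good (insert z V) (F \<union> {(x, z), (z, x)}) Z"
      and shr: "(w x + w z) * R' x \<le> w z * R x"
      and adv: "\<forall>u\<in>set (Z x). R' x \<le> w z * (u x - (Z z ! l0) x)" by blast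
    let ?Y = "\<lambda>y. map2 (+) (Y y) (Z y)"
    have lenY: "\<forall>y\<in>insert z V. length (Y y) = w y" using assms by (simp add: partial_def)
    have "partial ?Y R'"
      using assms good R' len lenY by (auto simp: partial_def intro!: good_add)
    moreover have "R' x \<le> (1 - 1 / n) * R x"
    proof -
      have pos: "0 < real (w x + w z)" using w by simp
      have "R' x \<le> (w z / (w x + w z)) * R x" using shr pos by (simp add: field_simps)
      also have "w z / (w x + w z) \<le> 1 - 1 / n"
      proof -
        \<comment> \<open>At least one of at most \<open>n\<close> equal parts stays with
          \<open>x\<close>.\<close>
        have "1 / n \<le> w x / (w x + w z)" using w by (intro frac_le) auto
        moreover have "w x / (w x + w z) + w z / (w x + w z) = 1"
          using pos by (simp flip: add_divide_distrib)
        ultimately show ?thesis by linarith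
      qed
      then have "(w z / (w x + w z)) * R x \<le> (1 - 1 / n) * R x"
        using R by (intro mult_right_mono) (auto simp: le_fun_def zero_fun_apply)
      finally show ?thesis .
    qed
    moreover have "\<exists>u\<in>set (Y x). u x - (Y z ! l) x + (if l = l0 then R' x / w z else 0) \<le> u' x - (?Y z ! l) x"
      if l: "l < w z" and u': "u' \<in> set (?Y x)" for l u'
    proof -
      from u' obtain a b where ab: "a \<in> set (Y x)" "b \<in> set (Z x)" "u' = a + b" by (rule set_map2E)
      have nth: "?Y z ! l = Y z ! l + Z z ! l" using l lenY len by simp
      have "Z z ! l \<in> set (Z z)" using l len by simp
      then have "(Z z ! l) x \<le> b x" using good ab(2) unfolding good_def by blast
      moreover have "R' x / w z \<le> b x - (Z z ! l0) x"
        using adv ab(2) w(2) by (simp add: field_simps)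
      ultimately show ?thesis using ab(1)
        by (intro bexI[of _ a]) (auto simp: ab(3) nth plus_fun_apply)
    qed
    ultimately have "?H (state ?Y R')" by blast
    then have "can_reach n ?H 0 ({#R'#} + (\<Sum>y\<in>insert z V. mset (?Y y)))"
      by (intro can_reach.stop) (simp add: state_def ac_simps)
    then have "can_reach n ?H 0 ({#R'#} + (\<Sum>y\<in>insert z V. mset (Y y)) + (\<Sum>y\<in>insert z V. mset (Z y)))"
      by (rule can_merge_sum[OF fin, rotated]) (use len lenY in auto)
    then show ?case by (simp add: M ac_simps)
  qed
  then show ?thesis by (simp add: state_def ac_simps)
qed

text \<open>Round \<open>i\<close>, counted from 0, favours slot \<open>i\<close>. Advantages are
  measured against the current residue; as it only shrinks and no advantage decreases, slots served
  earlier stay ahead. With \<open>i = w z\<close> every slot is served.\<close>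

lemma rotate_rounds:
  assumes "i \<le> w z" "1 \<le> i" "0 \<le> X"
  shows "can_reach n (\<lambda>M. \<exists>Y R. M = state Y R \<and> partial Y R \<and> 
     (\<forall>l<w z. \<forall>u\<in>set (Y x). (if l < i then R x / w z else 0) \<le> u x - (Y z ! l) x))
     (i * (C + w z)) {#X#}"
  using assms
proof (induction i)
  case (Suc i)
  show ?case
  proof (cases "i = 0")
    \<comment> \<open>The first round starts from the bare cake, where no lists of parts exist yet,
      and so uses \<open>attach_round\<close> directly.\<close>
    case True
    have "can_reach n (\<lambda>M. \<exists>Y R. M = state Y R \<and> partial Y R \<and> 
       (\<forall>l<w z. \<forall>u\<in>set (Y x). (if l < Suc i then R x / w z else 0) \<le> u x - (Y z ! l) x))
       ((C + w z) + 0) ({#X#} + {#})" (is "can_reach n ?H _ _")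
    proof (rule can_seq[OF attach_round[OF div V w(1) _ Suc.prems(3), of 0]], goal_cases)
      case 1
      then show ?case using w by simp
    next
      case (2 M)
      then obtain Z :: "nat \<Rightarrow> profile list" and R' :: profile where M: "M = (\<Sum>y\<in>insert z V. mset (Z y)) + {#R'#}" and R': "0 \<le> R'"
        and len: "\<forall>y\<in>insert z V. length (Z y) = w y"
        and good: "good (insert z V) (F \<union> {(x, z), (z, x)}) Z"
        and adv: "\<forall>u\<in>set (Z x). R' x \<le> w z * (u x - (Z z ! 0) x)" by blast
      have "partial Z R'" using R' len good by (simp add: partial_def)
      moreover have "(if l < Suc i then R' x / w z else 0) \<le> u x - (Z z ! l) x"
        if "l < w z" "u \<in> set (Z x)" for l u
      proof -
        have "Z z ! l \<in> set (Z z)" using that len by simp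
        then have "(Z z ! l) x \<le> u x" using good that(2) unfolding good_def by blast
        moreover have "R' x / w z \<le> u x - (Z z ! 0) x"
          using adv that(2) w(2) by (simp add: field_simps)
        ultimately show ?thesis using True by auto
      qed
      ultimately have "?H (state Z R')" by blast
      then have "can_reach n ?H 0 (state Z R')" by (rule can_reach.stop)
      moreover have "M + {#} = state Z R'" by (simp add: M state_def)
      ultimately show ?case by simp
    qed
    then show ?thesis using True by simp
  next
    case False
    have "can_reach n (\<lambda>M. \<exists>Y R. M = state Y R \<and> partial Y R \<and> 
       (\<forall>l<w z. \<forall>u\<in>set (Y x). (if l < Suc i then R x / w z else 0) \<le> u x - (Y z ! l) x))
       (i * (C + w z) + (C + w z)) ({#X#} + {#})" (is "can_reach n ?H _ _")
    proof (rule can_seq[OF Suc.IH], goal_cases)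
      case (4 M)
      then obtain Y R where Y: "M = state Y R" "partial Y R" 
        "\<And>l u. l < w z \<Longrightarrow> u \<in> set (Y x) \<Longrightarrow> (if l < i then R x / w z else 0) \<le> u x - (Y z ! l) x"
        by blast
      have "can_reach n ?H ((C + w z) + 0) (state Y R + {#})"
      proof (rule can_seq[OF one_round[OF Y(2), of i]], goal_cases)
        case 1
        then show ?case using Suc.prems by simp
      next
        case (2 M')
        then obtain Y' R' where Y': "M' = state Y' R'" "partial Y' R'" "R' x \<le> (1 - 1 / n) * R x" and
          adv: "\<And>l u'. l < w z \<Longrightarrow> u' \<in> set (Y' x) \<Longrightarrow>
            \<exists>u\<in>set (Y x). u x - (Y z ! l) x + (if l = i then R' x / w z else 0) \<le> u' x - (Y' z ! l) x"
          by blast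
        have "0 \<le> R x" using Y(2) by (simp add: partial_def le_fun_def zero_fun_apply)
        then have "(1 - 1 / n) * R x \<le> 1 * R x" by (intro mult_right_mono) auto
        with Y'(3) have "R' x \<le> R x" by simp
        then have RR: "R' x / w z \<le> R x / w z" by (intro divide_right_mono) auto
        have "(if l < Suc i then R' x / w z else 0) \<le> u' x - (Y' z ! l) x"
          if l: "l < w z" "u' \<in> set (Y' x)" for l u'
        proof -
          from adv[OF l] obtain u where "u \<in> set (Y x)"
            "u x - (Y z ! l) x + (if l = i then R' x / w z else 0) \<le> u' x - (Y' z ! l) x" by blast
          with Y(3)[OF l(1) this(1)] RR show ?thesis by (auto split: if_splits)
        qed
        with Y' have "?H M'" by blast
        then have "can_reach n ?H 0 M'" by (rule can_reach.stop)
        then show ?case by simp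
      qed
      then show ?case using Y by simp
    qed (use False Suc.prems in auto)
    then show ?thesis by (simp add: ac_simps)
  qed
qed simp

text \<open>Any slot may be favoured now, and slot 0 is taken: the aim is the decay of the residue
  while the advantage \<open>a\<close> persists. The bound \<open>d\<close> is separate from
  \<open>R x\<close> so that the induction can pass on \<open>(1 - 1 / n) * d\<close>.\<close>

lemma shrink_rounds:
  assumes "partial Y R" "\<forall>l<w z. \<forall>u\<in>set (Y x). a \<le> u x - (Y z ! l) x" "R x \<le> d"
  shows "can_reach n (\<lambda>M. \<exists>Y R. M = state Y R \<and> partial Y R \<and> R x \<le> (1 - 1 / n) ^ j * d \<and>
     (\<forall>l<w z. \<forall>u\<in>set (Y x). a \<le> u x - (Y z ! l) x))
     (j * (C + w z)) (state Y R)"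
  using assms
proof (induction j arbitrary: Y R d)
  case 0
  then have "R x \<le> (1 - 1 / n) ^ 0 * d" by simp
  with 0 show ?case by (intro can_reach.stop) blast
next
  case (Suc j)
  let ?H = "\<lambda>M. \<exists>Y R. M = state Y R \<and> partial Y R \<and> R x \<le> (1 - 1 / n) ^ Suc j * d \<and>
     (\<forall>l<w z. \<forall>u\<in>set (Y x). a \<le> u x - (Y z ! l) x)"
  have n: "(0::real) \<le> 1 - 1 / n" by (cases "n = 0") auto
  have "can_reach n ?H ((C + w z) + j * (C + w z)) (state Y R + {#})"
  proof (rule can_seq[OF one_round[OF Suc.prems(1), of 0]], goal_cases)
    case 1
    then show ?case using w by simp
  next
    case (2 M')
    then obtain Y' R' where Y': "M' = state Y' R'" "partial Y' R'" "R' x \<le> (1 - 1 / n) * R x" and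
      adv: "\<And>l u'. l < w z \<Longrightarrow> u' \<in> set (Y' x) \<Longrightarrow>
        \<exists>u\<in>set (Y x). u x - (Y z ! l) x + (if l = 0 then R' x / w z else 0) \<le> u' x - (Y' z ! l) x"
      by blast
    have "0 \<le> R' x / w z" using Y'(2) by (simp add: partial_def le_fun_def zero_fun_apply)
    have "a \<le> u' x - (Y' z ! l) x" if l: "l < w z" "u' \<in> set (Y' x)" for l u'
    proof -
      from adv[OF l] obtain u where "u \<in> set (Y x)"
        "u x - (Y z ! l) x + (if l = 0 then R' x / w z else 0) \<le> u' x - (Y' z ! l) x" by blast
      moreover have "a \<le> u x - (Y z ! l) x" using Suc.prems(2) l(1) \<open>u \<in> set (Y x)\<close> by blast
      ultimately show ?thesis using \<open>0 \<le> R' x / w z\<close> by (auto split: if_splits)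
    qed
    moreover have "R' x \<le> (1 - 1 / n) * d"
      using Y'(3) mult_left_mono[OF Suc.prems(3) n] by linarith
    ultimately have "can_reach n (\<lambda>M. \<exists>Y R. M = state Y R \<and> partial Y R \<and> R x \<le> (1 - 1 / n) ^ j * ((1 - 1 / n) * d) \<and>
     (\<forall>l<w z. \<forall>u\<in>set (Y x). a \<le> u x - (Y z ! l) x)) (j * (C + w z)) (state Y' R')"
      using Y'(2) by (intro Suc.IH) auto
    then show ?case by (simp add: Y' ac_simps)
  qed
  then show ?case by simp
qed

text \<open>The agent \<open>z\<close> cuts \<open>R\<close> into equal shares, one per slot. For
  \<open>x\<close> a share is worth at most \<open>R x\<close>, which its advantage covers;
  \<open>z\<close> itself only gains.\<close>

lemma hand_over_residue:
  assumes "partial Y R" "\<forall>l<w z. \<forall>u\<in>set (Y x). R x \<le> u x - (Y z ! l) x"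
  shows "can_reach n (\<lambda>M. \<exists>Y. M = (\<Sum>y\<in>insert z V. mset (Y y)) \<and> (\<forall>y\<in>insert z V. length (Y y) = w y) \<and>
     good (insert z V) (F \<union> {(x, z), (z, x)}) Y) (w z) (state Y R)" (is "can_reach n ?H _ _")
proof -
  obtain b where b: "w z = Suc b" using w by (cases "w z") auto
  have R: "0 \<le> R" using assms by (simp add: partial_def)
  have len: "\<And>y. y \<in> insert z V \<Longrightarrow> length (Y y) = w y" and
    good: "good (insert z V) (F \<union> {(x, z), (z, x)}) Y"
    using assms by (auto simp: partial_def)
  define M0 where "M0 = (\<Sum>y\<in>V. mset (Y y))"
  let ?c = "R z / real (Suc b)"
  have "can_reach n ?H (b + 1) (({#R#} + (M0 + mset (Y z))) + {#})"
  proof (rule can_seq[OF can_equal[OF V(4), of ?c]], goal_cases)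
    case 1
    then show ?case using R by (simp add: le_fun_def zero_fun_apply)
  next
    case 2
    then show ?case using R .
  next
    case 3
    then show ?case by (simp del: of_nat_Suc)
  next
    case (4 M)
    then obtain ps where ps: "M = mset ps + (M0 + mset (Y z))" "length ps = w z"
      "\<And>p. p \<in> set ps \<Longrightarrow> 0 \<le> p \<and> p \<le> R \<and> p z = ?c" using b by auto
    let ?Y = "Y(z := map2 (+) (Y z) ps)"
    have xz: "x \<noteq> z" using V by auto
    have Yz: "\<exists>l<w z. \<exists>p\<in>set ps. u = Y z ! l + p" if "u \<in> set (?Y z)" for u
      using that len ps(2) by (auto simp: set_zip)
    have eq_z: "u z = u' z" if h: "u \<in> set (?Y z)" "u' \<in> set (?Y z)" for u u'
    proof -
      obtain l p l' p' where lp: "l < w z" "p \<in> set ps" "u = Y z ! l + p" "l' < w z" "p' \<in> set ps" "u' = Y z ! l' + p'"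
        using Yz[OF h(1)] Yz[OF h(2)] by blast
      moreover from this have "(Y z ! l) z = (Y z ! l') z"
        using good len nth_mem[of _ "Y z"] unfolding good_def by auto
      moreover have "p z = ?c" "p' z = ?c" using ps(3) lp by blast+
      ultimately show ?thesis by (simp add: plus_fun_apply)
    qed
    have x_ge: "u' x \<le> u x" if h: "u \<in> set (Y x)" "u' \<in> set (?Y z)" for u u'
    proof -
      obtain l p where "l < w z" "p \<in> set ps" "u' = Y z ! l + p"
        using Yz[OF h(2)] by blast
      moreover from this have "p x \<le> R x" using ps(3) by (auto simp: le_fun_def)
      moreover have "R x \<le> u x - (Y z ! l) x" using assms(2) h(1) \<open>l < w z\<close> by blast
      ultimately show ?thesis by (simp add: plus_fun_apply)
    qed
    have z_ge: "u z \<le> u' z" if h: "u \<in> set (Y x)" "u' \<in> set (?Y z)" for u u'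
    proof -
      obtain l p where lp: "l < w z" "p \<in> set ps" "u' = Y z ! l + p"
        using Yz[OF h(2)] by blast
      then have "Y z ! l \<in> set (Y z)" using len by simp
      then have "u z \<le> (Y z ! l) z" using good h(1) unfolding good_def by blast
      moreover have "0 \<le> p z" using ps(3)[OF lp(2)] R by (simp add: le_fun_def zero_fun_apply)
      ultimately show ?thesis using lp h by (simp add: plus_fun_apply)
    qed
    have "good (insert z V) (F \<union> {(x, z), (z, x)}) ?Y"
      unfolding good_def
    proof (intro conjI ballI, goal_cases)
      case (1 y u u')
      show ?case
      proof (cases "y = z")
        case True
        then show ?thesis using 1 eq_z by blast
      next
        case False
        then have "u \<in> set (Y y)" "u' \<in> set (Y y)" using 1 by auto
        then show ?thesis using 1(1) good unfolding good_def by blast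
      qed
    next
      case (2 e)
      obtain y y' where e: "e = (y, y')" by force
      have "u' y \<le> u y" if u: "u \<in> set (?Y y)" "u' \<in> set (?Y y')" for u u'
      proof -
        consider "(y, y') \<in> F" | "y = x" "y' = z" | "y = z" "y' = x" using 2 e by auto
        then show ?thesis
        proof cases
          case 1
          \<comment> \<open>\<open>F\<close> lives on \<open>V\<close>, which excludes
            \<open>z\<close>, so these comparisons do not see the added shares.\<close>
          then have "y \<noteq> z" "y' \<noteq> z" using V by auto
          then have "u \<in> set (Y y)" "u' \<in> set (Y y')" using u by auto
          then show ?thesis using good 1 unfolding good_def by blast
        next
          case 2
          then show ?thesis using u xz x_ge by simp
        next
          case 3
          then show ?thesis using u xz z_ge[of u' u] by simp
        qed
      qed
      then show ?case using e by auto
    qed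
    moreover have "\<forall>y\<in>insert z V. length (?Y y) = w y" using len ps(2) by auto
    moreover have "(\<Sum>y\<in>insert z V. mset (?Y y)) = M0 + mset (map2 (+) (Y z) ps)"
    proof -
      have "(\<Sum>y\<in>V. mset (?Y y)) = M0" unfolding M0_def using V by (intro sum.cong) auto
      then show ?thesis using V by (simp add: ac_simps)
    qed
    ultimately have "?H (M0 + mset (map2 (+) (Y z) ps))" by metis
    then have "can_reach n ?H 1 (M0 + mset (map2 (+) (Y z) ps))" by (rule can_reach.stop)
    then have "can_reach n ?H 1 (M0 + mset (Y z) + mset ps)"
      using len ps(2) by (intro can_merge_zip) auto
    then show ?case by (simp add: ps(1) ac_simps)
  qed
  then show ?thesis using V b by (simp add: state_def M0_def ac_simps)
qed

end

lemma divides_into_mono: "divides_into n C V F w \<Longrightarrow> C \<le> C' \<Longrightarrow> divides_into n C' V F w"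
  unfolding divides_into_def by (intro allI impI, rule can_mono) auto

context attach begin

text \<open>At most \<open>n\<close> rounds serve every slot and
  \<open>n * nat \<lceil>ln n\<rceil>\<close> more shrink the residue, each for at most
  \<open>C + n\<close>; at most \<open>n\<close> cuts hand it over. The shrinking suffices because
  \<open>(1 - 1 / n) ^ n \<le> exp (- 1)\<close>, so the residue falls to the fraction
  \<open>1 / n \<le> 1 / w z\<close> that \<open>x\<close> holds as advantage.\<close>

lemma divides_into_insert:
  "divides_into n ((n + n * nat \<lceil>ln n\<rceil>) * (C + n) + n) (insert z V) (F \<union> {(x, z), (z, x)}) w"
  unfolding divides_into_def
proof (intro allI impI)
  fix X :: profile assume X: "0 \<le> X"
  define L where "L = nat \<lceil>ln (real n)\<rceil>"
  let ?K = "w z * (C + w z) + (n * L * (C + w z) + w z)"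
  have n1: "n \<ge> 1" and wzn: "w z \<le> n" using w by auto
  have "can_reach n (\<lambda>M. \<exists>Y. M = (\<Sum>y\<in>insert z V. mset (Y y)) \<and> (\<forall>y\<in>insert z V. length (Y y) = w y) \<and>
      good (insert z V) (F \<union> {(x, z), (z, x)}) Y) ?K ({#X#} + {#})" (is "can_reach n ?H _ _")
  proof (rule can_seq[OF rotate_rounds[of "w z" X]], goal_cases)
    case (4 M)
    then obtain Y :: "nat \<Rightarrow> profile list" and R :: profile where Y: "M = state Y R" "partial Y R"
      "\<forall>l<w z. \<forall>u\<in>set (Y x). (if l < w z then R x / w z else 0) \<le> u x - (Y z ! l) x" by blast
    then have adv: "\<forall>l<w z. \<forall>u\<in>set (Y x). R x / w z \<le> u x - (Y z ! l) x" by simp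
    have R0: "0 \<le> R x" using Y(2) by (simp add: partial_def le_fun_def zero_fun_apply)
    have "can_reach n ?H (n * L * (C + w z) + w z) (state Y R + {#})"
    proof (rule can_seq[OF shrink_rounds[OF Y(2) adv order_refl, of "n * L"]], goal_cases)
      case (1 M')
      then obtain Y' :: "nat \<Rightarrow> profile list" and R' :: profile where Y': "M' = state Y' R'" "partial Y' R'"
        "R' x \<le> (1 - 1 / n) ^ (n * L) * R x"
        "\<forall>l<w z. \<forall>u\<in>set (Y' x). R x / w z \<le> u x - (Y' z ! l) x" by blast
      have "(1 - 1 / real n) ^ (n * L) \<le> exp (- 1 / real n) ^ (n * L)"
        using n1 exp_ge_add_one_self[of "- 1 / real n"] by (intro power_mono) auto
      also have "\<dots> = exp (real (n * L) * (- 1 / real n))" by (rule exp_of_nat_mult[symmetric])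
      also have "real (n * L) * (- 1 / real n) = - real L" using n1 by simp
      also have "exp (- real L) \<le> exp (- ln (real n))" using real_nat_ceiling_ge[of "ln (real n)"] by (simp add: L_def)
      also have "\<dots> = 1 / real n" using n1 by (simp add: exp_minus inverse_eq_divide)
      also have "\<dots> \<le> 1 / w z" using w wzn by (intro divide_left_mono) auto
      finally have "(1 - 1 / real n) ^ (n * L) * R x \<le> 1 / w z * R x" using R0 by (rule mult_right_mono)
      also have "1 / w z * R x = R x / w z" by simp
      finally have "R' x \<le> R x / w z" using Y'(3) by linarith
      have "\<forall>l<w z. \<forall>u\<in>set (Y' x). R' x \<le> u x - (Y' z ! l) x"
      proof (intro allI impI ballI)
        fix l u assume "l < w z" "u \<in> set (Y' x)"
        with Y'(4) have "R x / w z \<le> u x - (Y' z ! l) x" by blast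
        with \<open>R' x \<le> R x / w z\<close> show "R' x \<le> u x - (Y' z ! l) x" by linarith
      qed
      from hand_over_residue[OF Y'(2) this] show ?case by (simp add: Y'(1))
    qed
    then show ?case by (simp add: Y(1))
  qed (use w X in auto)
  moreover have "?K \<le> (n + n * L) * (C + n) + n"
  proof -
    have "?K \<le> n * (C + n) + (n * L * (C + n) + n)"
      using wzn by (intro add_mono mult_le_mono le_refl) 
    then show ?thesis by (simp add: algebra_simps)
  qed
  ultimately have "can_reach n ?H ((n + n * L) * (C + n) + n) ({#X#} + {#})" by (rule can_mono)
  then show "can_reach n ?H ((n + n * nat \<lceil>ln n\<rceil>) * (C + n) + n) {#X#}" by (simp add: L_def)
qed

end

section \<open>Trees built leaf by leaf\<close>

text \<open>Every edge is stored in both directions, so that rule induction matches the step made by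
  \<open>divides_into_insert\<close>.\<close>

inductive tree_graph :: "nat set \<Rightarrow> (nat \<times> nat) set \<Rightarrow> bool" where
  single: "tree_graph {r} {}"
| leaf: "tree_graph V F \<Longrightarrow> x \<in> V \<Longrightarrow> z \<notin> V \<Longrightarrow> tree_graph (insert z V) (F \<union> {(x, z), (z, x)})"

lemma tree_graph_finite: "tree_graph V F \<Longrightarrow> finite V \<and> V \<noteq> {} \<and> F \<subseteq> V \<times> V \<and> sym F"
  by (induction rule: tree_graph.induct) (auto simp: sym_def)

lemma tree_graph_card:
  "tree_graph V F \<Longrightarrow> card {(i, j). (i, j) \<in> F \<and> i < j} = card V - 1"
proof (induction rule: tree_graph.induct)
  case (leaf V F x z)
  have fin: "finite V" "V \<noteq> {}" "F \<subseteq> V \<times> V" using tree_graph_finite[OF leaf(1)] by auto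
  then have finF: "finite F" by (metis finite_SigmaI finite_subset)
  let ?e = "if x < z then (x, z) else (z, x)"
  have "x \<noteq> z" using leaf by auto
  then have "{(i, j). (i, j) \<in> F \<union> {(x, z), (z, x)} \<and> i < j} = insert ?e {(i, j). (i, j) \<in> F \<and> i < j}"
    by auto
  moreover have "?e \<notin> {(i, j). (i, j) \<in> F \<and> i < j}" using fin(3) leaf by auto
  moreover have "finite {(i, j). (i, j) \<in> F \<and> i < j}" by (rule finite_subset[OF _ finF]) auto
  moreover have "card V \<ge> 1" using fin by (simp add: Suc_leI card_gt_0_iff)
  ultimately show ?case using leaf fin by simp
qed simp

text \<open>A tree is grown inside the graph from vertex 0; by connectivity some edge leaves it
  until it spans all vertices. It then has \<open>n - 1\<close> edges, as many as the graph, so no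
  edge of \<open>E\<close> is left out.\<close>

lemma is_tree_tree_graph:
  assumes "is_tree n E"
  shows "tree_graph {..<n} {(i, j). E i j}"
proof -
  have n: "n \<ge> 1" and E: "\<And>i j. E i j \<Longrightarrow> i < n \<and> j < n \<and> i \<noteq> j \<and> E j i"
    and conn: "\<And>i j. i < n \<Longrightarrow> j < n \<Longrightarrow> E\<^sup>*\<^sup>* i j"
    and cE: "card {(i, j). E i j \<and> i < j} = n - 1"
    using assms unfolding is_tree_def by blast+
  have "\<exists>V F. tree_graph V F \<and> V \<subseteq> {..<n} \<and> F \<subseteq> {(i, j). E i j} \<and> card V = Suc k" if "k < n" for k
    using that
  proof (induction k)
    case 0
    then show ?case using tree_graph.single[of 0] n by (intro exI[of _ "{0}"] exI[of _ "{}"]) auto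
  next
    case (Suc k)
    then obtain V F where VF: "tree_graph V F" "V \<subseteq> {..<n}" "F \<subseteq> {(i, j). E i j}" "card V = Suc k"
      by auto
    have fin: "finite V" "V \<noteq> {}" using tree_graph_finite[OF VF(1)] by auto
    have "V \<noteq> {..<n}" using VF Suc.prems by auto
    then obtain r t where rt: "r \<in> V" "t < n" "t \<notin> V" using fin VF(2) by blast
    have "\<exists>x\<in>V. \<exists>z. z \<notin> V \<and> E x z"
    proof (rule ccontr)
      assume "\<not> ?thesis"
      then have closed: "\<And>x z. x \<in> V \<Longrightarrow> E x z \<Longrightarrow> z \<in> V" by blast
      have "E\<^sup>*\<^sup>* r t" using conn rt VF(2) by blast
      then have "t \<in> V" by (induction rule: rtranclp_induct) (use rt closed in auto)
      then show False using rt by simp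
    qed
    then obtain x z where xz: "x \<in> V" "z \<notin> V" "E x z" by blast
    have "tree_graph (insert z V) (F \<union> {(x, z), (z, x)})" using VF xz by (intro tree_graph.leaf)
    moreover have "insert z V \<subseteq> {..<n}" "F \<union> {(x, z), (z, x)} \<subseteq> {(i, j). E i j}"
      using VF xz E by auto
    moreover have "card (insert z V) = Suc (Suc k)" using VF xz fin by simp
    ultimately show ?case by blast
  qed
  from this[of "n - 1"] n obtain V F where VF: "tree_graph V F" "V \<subseteq> {..<n}"
    "F \<subseteq> {(i, j). E i j}" "card V = n" by auto
  have V: "V = {..<n}" using VF by (intro card_subset_eq) auto
  have "finite {(i, j). E i j \<and> i < j}"
    by (rule finite_subset[of _ "{..<n} \<times> {..<n}"]) (use E in auto)
  moreover have "{(i, j). (i, j) \<in> F \<and> i < j} \<subseteq> {(i, j). E i j \<and> i < j}" using VF by auto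
  ultimately have eq: "{(i, j). (i, j) \<in> F \<and> i < j} = {(i, j). E i j \<and> i < j}"
    using tree_graph_card[OF VF(1)] VF(4) cE by (intro card_subset_eq) auto
  have "(i, j) \<in> F" if "E i j" for i j
  proof (cases "i < j")
    case True
    then show ?thesis using eq that by auto
  next
    case False
    then have "j < i" "E j i" using E[OF that] by auto
    then have "(j, i) \<in> F" using eq by auto
    then show ?thesis using tree_graph_finite[OF VF(1)] by (auto dest: symD)
  qed
  then have "F = {(i, j). E i j}" using VF by auto
  then show ?thesis using VF V by simp
qed

text \<open>The smaller tree carries weight \<open>w x + w z\<close> at \<open>x\<close>, so the
  total weight is unchanged and its bound \<open>n\<close> passes down the induction. Each leaf
  multiplies the cost by at most the base of the power.\<close>

lemma tree_divides_into:
  fixes w :: "nat \<Rightarrow> nat" and n :: nat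
  assumes "tree_graph V F" "V \<subseteq> {..<n}" "\<forall>y\<in>V. w y \<ge> 1" "sum w V \<le> n"
  shows "divides_into n (n * (n + n * nat \<lceil>ln (real n)\<rceil> + 2) ^ card V) V F w"
  using assms
proof (induction arbitrary: w rule: tree_graph.induct)
  case (single r)
  have "divides_into n (w r) {r} {} w" using single by (intro divides_into_single) auto
  moreover have "w r \<le> n * (n + n * nat \<lceil>ln (real n)\<rceil> + 2) ^ card {r}"
    using single by (simp add: trans_le_add1 distrib_left)
  ultimately show ?case by (rule divides_into_mono)
next
  case (leaf V F x z)
  define m where "m = n + n * nat \<lceil>ln (real n)\<rceil>"
  define C where "C = n * (m + 2) ^ card V"
  have fin: "finite V" "F \<subseteq> V \<times> V" using tree_graph_finite[OF leaf(1)] by auto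
  have xz: "x \<noteq> z" using leaf by auto
  have s: "sum w (insert z V) = w z + w x + sum w (V - {x})"
    using fin leaf by (simp add: sum.remove[of V x])
  have "sum (w(x := w x + w z)) V = w x + w z + sum w (V - {x})"
    using fin leaf by (simp add: sum.remove[of V x])
  then have "divides_into n C V F (w(x := w x + w z))"
    unfolding C_def m_def using leaf.prems s by (intro leaf.IH) auto
  moreover have "w x + w z \<le> n" using s leaf.prems by simp
  ultimately have "attach n C V F w x z"
    using fin leaf by (unfold_locales) auto
  then have "divides_into n (m * (C + n) + n) (insert z V) (F \<union> {(x, z), (z, x)}) w"
    unfolding m_def by (rule attach.divides_into_insert)
  moreover have "m * (C + n) + n \<le> n * (m + 2) ^ card (insert z V)"
  proof -
    \<comment> \<open>The summand 2 in the base absorbs the lower-order terms: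
      \<open>m * n + n \<le> n * (m + 2) \<le> C\<close>, the last because \<open>card V\<close> is
      positive.\<close>
    have "0 < card V" using fin(1) leaf.hyps(2) by (auto simp: card_gt_0_iff)
    then have "(m + 2) ^ 1 \<le> (m + 2) ^ card V" by (intro power_increasing) auto
    then have "n * (m + 2) \<le> C" unfolding C_def by (intro mult_left_mono) auto
    moreover have "n * (m + 2) ^ card (insert z V) = (m + 2) * C"
      using fin(1) leaf.hyps by (simp only: C_def card_insert_disjoint power_Suc mult.left_commute) simp
    ultimately show ?thesis by (simp add: algebra_simps)
  qed
  ultimately show ?case unfolding m_def by (rule divides_into_mono)
qed

section \<open>From the game to Robertson--Webb protocols\<close>

lemma nonneg_valuation: "valuation v \<Longrightarrow> piece S \<Longrightarrow> 0 \<le> v S"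
  by (simp add: valuation_def)

lemma valuation_Un: "valuation v \<Longrightarrow> piece S \<Longrightarrow> piece T \<Longrightarrow> S \<inter> T = {} \<Longrightarrow> v (S \<union> T) = v S + v T"
  by (simp add: valuation_def)

lemma piece_interval: "is_interval I \<Longrightarrow> I \<subseteq> {0..1} \<Longrightarrow> piece I"
  unfolding piece_def by (intro conjI exI[of _ "{I}"]) auto

lemma piece_Un: "piece S \<Longrightarrow> piece T \<Longrightarrow> piece (S \<union> T)"
proof -
  assume "piece S" "piece T"
  then obtain F G where "finite F" "\<forall>I\<in>F. is_interval I" "S = \<Union>F" "finite G" "\<forall>I\<in>G. is_interval I" "T = \<Union>G"
    "S \<subseteq> {0..1}" "T \<subseteq> {0..1}"
    unfolding piece_def by blast
  then show ?thesis unfolding piece_def by (intro conjI exI[of _ "F \<union> G"]) auto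
qed

lemma valuation_empty: "valuation v \<Longrightarrow> v {} = 0"
  using valuation_Un[of v "{}" "{}"] piece_interval[of "{}"] by simp

text \<open>Non-atomicity with \<open>lam = 0\<close> on the degenerate interval
  \<open>{x..x}\<close> leaves only \<open>y' = x\<close>.\<close>

lemma valuation_point:
  assumes "valuation v" "0 \<le> x" "x \<le> 1"
  shows "v {x} = 0"
proof -
  have "\<exists>y'. x \<le> y' \<and> y' \<le> x \<and> v {x..y'} = 0 * v {x..x}"
    using assms unfolding valuation_def by (metis order_refl zero_le_one)
  then show ?thesis by force
qed

lemma valuation_ioc:
  assumes "valuation v" "0 \<le> l" "l \<le> u" "u \<le> 1"
  shows "v {l<..u} = v {l..u}"
proof -
  have "v ({l} \<union> {l<..u}) = v {l} + v {l<..u}"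
    using assms by (intro valuation_Un piece_interval) (auto simp: is_interval_1)
  moreover have "{l} \<union> {l<..u} = {l..u}" using assms by auto
  ultimately show ?thesis using valuation_point[OF assms(1), of l] assms by simp
qed

lemma valuation_split:
  assumes "valuation v" "0 \<le> l" "l \<le> y" "y \<le> u" "u \<le> 1"
  shows "v {l<..u} = v {l<..y} + v {y<..u}"
proof -
  have "v ({l<..y} \<union> {y<..u}) = v {l<..y} + v {y<..u}"
    using assms by (intro valuation_Un piece_interval) auto
  moreover have "{l<..y} \<union> {y<..u} = {l<..u}" using assms by auto
  ultimately show ?thesis by simp
qed

text \<open>
An atom is a half-open interval with its known values; these avoid any overlap at the cut points,
and the point 0 is handed out separately at the end.
\<close>

type_synonym atom = "real \<times> real \<times> profile"

definition value_of :: "atom multiset \<Rightarrow> profile" where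
  "value_of p = (\<Sum>(l, u, a)\<in>#p. a)"

text \<open>Disjointness and exhaustion are both read off this count. It is additive, so moving
  atoms between pieces leaves the total unchanged.\<close>

definition cover :: "atom multiset \<Rightarrow> real \<Rightarrow> nat" where
  "cover p t = (\<Sum>(l, u, a)\<in>#p. if l < t \<and> t \<le> u then 1 else 0)"

definition region :: "atom multiset \<Rightarrow> real set" where
  "region p = (\<Union>(l, u, a)\<in>set_mset p. {l<..u})"

text \<open>Kept apart from \<open>proper_atom\<close>: a protocol is fixed before the valuations
  are known, so the truth of recorded values is a condition on \<open>v\<close>.\<close>

definition true_atom :: "nat \<Rightarrow> (nat \<Rightarrow> real set \<Rightarrow> real) \<Rightarrow> atom \<Rightarrow> bool" where
  "true_atom n v = (\<lambda>(l, u, a). \<forall>i<n. v i {l<..u} = a i)"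

definition proper_atom :: "atom \<Rightarrow> bool" where
  "proper_atom = (\<lambda>(l, u, a). 0 \<le> l \<and> l \<le> u \<and> u \<le> 1 \<and> 0 \<le> a)"

lemma value_of_simps [simp]:
  "value_of {#} = 0" "value_of (add_mset (l, u, a) p) = a + value_of p" "value_of (p + q) = value_of p + value_of q"
  by (simp_all add: value_of_def)

lemma cover_simps [simp]:
  "cover {#} t = 0" "cover (add_mset (l, u, a) p) t = (if l < t \<and> t \<le> u then 1 else 0) + cover p t"
  "cover (p + q) t = cover p t + cover q t"
  by (simp_all add: cover_def)

lemma region_simps [simp]:
  "region {#} = {}" "region (add_mset (l, u, a) p) = {l<..u} \<union> region p" "region (p + q) = region p \<union> region q"
  by (auto simp: region_def)

lemma region_cover: "t \<in> region p \<longleftrightarrow> cover p t > 0"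
  by (induction p) (auto split: if_splits)

lemma region_piece: "\<forall>a\<in>#p. proper_atom a \<Longrightarrow> piece (region p)"
proof (induction p)
  case empty
  then show ?case using piece_interval[of "{}"] by simp
next
  case (add e p)
  obtain l u a where e: "e = (l, u, a)" by (cases e)
  have "piece {l<..u}" using add.prems by (intro piece_interval) (auto simp: e proper_atom_def)
  then show ?case using add by (auto simp: e intro: piece_Un)
qed

lemma region_value:
  assumes "valuation (v i)" "i < n" "\<forall>a\<in>#p. proper_atom a" "\<forall>a\<in>#p. true_atom n v a" "\<And>t. cover p t \<le> 1"
  shows "v i (region p) = value_of p i"
  using assms(3-)
proof (induction p)
  case empty
  then show ?case using valuation_empty[OF assms(1)] by (simp add: zero_fun_apply)
next
  case (add e p)
  obtain l u a where e: "e = (l, u, a)" by (cases e)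
  have dis: "{l<..u} \<inter> region p = {}"
  proof (rule ccontr)
    assume "\<not> ?thesis"
    then obtain t where "l < t" "t \<le> u" "cover p t > 0" by (auto simp: region_cover)
    then show False using add.prems(3)[of t] by (simp add: e)
  qed
  have "v i ({l<..u} \<union> region p) = v i {l<..u} + v i (region p)"
    using add.prems dis by (intro valuation_Un assms(1) region_piece piece_interval) (auto simp: e proper_atom_def)
  moreover have "v i (region p) = value_of p i"
  proof (rule add.IH)
    show "cover p t \<le> 1" for t using add.prems(3)[of t] by (simp add: e)
  qed (use add.prems in auto)
  moreover have "v i {l<..u} = a i" using add.prems(2) assms(2) by (simp add: e true_atom_def)
  ultimately show ?case by (simp add: e plus_fun_apply)
qed

section \<open>Query sequences and the place of a cut\<close>

text \<open>Coordinates from \<open>m\<close> on default to 0, which lies below every nonnegative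
  profile, so the collected answers can serve as the values of a part of an atom.\<close>

primrec eval_all :: "nat \<Rightarrow> real \<Rightarrow> real \<Rightarrow> (profile \<Rightarrow> protocol) \<Rightarrow> protocol" where
  "eval_all 0 x y k = k (\<lambda>_. 0)"
| "eval_all (Suc m) x y k = Eval m x y (\<lambda>r. eval_all m x y (\<lambda>a. k (a(m := r))))"

inductive_cases runs_OutputE: "runs v (Output A') A q"
inductive_cases runs_EvalE: "runs v (Eval i x y k) A q"
inductive_cases runs_CutE: "runs v (Cut i x t k) A q"

lemma runs_eval_all:
  "runs v (eval_all m x y k) A q \<Longrightarrow>
   \<exists>q'. q = q' + m \<and> runs v (k (\<lambda>j. if j < m then v j {x..y} else 0)) A q'"
proof (induction m arbitrary: k q)
  case (Suc m)
  from Suc.prems obtain q1 where q1: "q = Suc q1"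
    "runs v (eval_all m x y (\<lambda>a. k (a(m := v m {x..y})))) A q1"
    by (auto elim: runs_EvalE)
  from Suc.IH[OF q1(2)] obtain q' where "q1 = q' + m"
    "runs v (k ((\<lambda>j. if j < m then v j {x..y} else 0)(m := v m {x..y}))) A q'" by blast
  moreover have "(\<lambda>j. if j < m then v j {x..y} else 0)(m := v m {x..y}) = (\<lambda>j. if j < Suc m then v j {x..y} else 0)"
    by auto
  ultimately show ?case using q1 by auto
qed simp

text \<open>Running through the atoms until their sum for \<open>i\<close> reaches \<open>t\<close>
  shows that only one atom has to be cut; an empty piece would offer none.\<close>

lemma split_position:
  assumes "\<forall>a\<in>#p. proper_atom a" "0 \<le> t" "t \<le> value_of p i" "p \<noteq> {#}"
  shows "\<exists>p1 l u a p2. p = p1 + {#(l, u, a)#} + p2 \<and> value_of p1 i \<le> t \<and> t \<le> value_of p1 i + a i"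
  using assms
proof (induction p arbitrary: t)
  case (add e p)
  obtain l u a where e: "e = (l, u, a)" by (cases e)
  show ?case
  proof (cases "t \<le> a i")
    case True
    then show ?thesis using add.prems
      by (intro exI[of _ "{#}"] exI[of _ l] exI[of _ u] exI[of _ a] exI[of _ p]) (auto simp: e zero_fun_apply)
  next
    case False
    show ?thesis
    proof (cases "p = {#}")
      case True
      then show ?thesis using add.prems False by (auto simp: e plus_fun_apply zero_fun_apply)
    next
      case nonempty: False
      have "0 \<le> t - a i" "t - a i \<le> value_of p i" "\<forall>a\<in>#p. proper_atom a"
        using add.prems False by (auto simp: e plus_fun_apply)
      from add.IH[OF this(3,1,2) nonempty] obtain p1 l' u' a' p2 where
        "p = p1 + {#(l', u', a')#} + p2" "value_of p1 i \<le> t - a i" "t - a i \<le> value_of p1 i + a' i"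
        by blast
      then show ?thesis
        by (intro exI[of _ "add_mset e p1"] exI[of _ l'] exI[of _ u'] exI[of _ a'] exI[of _ p2])
          (auto simp: e plus_fun_apply)
    qed
  qed
qed simp


text \<open>Recovers from a multiset of pieces which piece belongs to which agent, given only the
  agreement of values.\<close>

lemma image_mset_eq_indexed:
  assumes "finite I" "image_mset f S = image_mset Y (mset_set I)"
  shows "\<exists>p. S = image_mset p (mset_set I) \<and> (\<forall>i\<in>I. f (p i) = Y i)"
  using assms
proof (induction I arbitrary: S rule: finite_induct)
  case (insert i I)
  then have "image_mset f S = add_mset (Y i) (image_mset Y (mset_set I))" by simp
  from msed_map_invR[OF this] obtain S' s where S: "S = add_mset s S'" "f s = Y i"
    "image_mset f S' = image_mset Y (mset_set I)" by (metis add_mset_add_single)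
  from insert.IH[OF S(3)] obtain p where p: "S' = image_mset p (mset_set I)" "\<forall>j\<in>I. f (p j) = Y j" by blast
  have "image_mset (p(i := s)) (mset_set I) = image_mset p (mset_set I)"
    using insert.hyps by (intro image_mset_cong) auto
  then have "S = image_mset (p(i := s)) (mset_set (insert i I))"
    using insert.hyps S(1) p(1) by (simp del: fun_upd_apply) simp
  moreover have "\<forall>j\<in>insert i I. f ((p(i := s)) j) = Y j"
    using insert.hyps S(2) p(2) by auto
  ultimately show ?case by blast
qed simp

lemma cover_sum_mset: "finite I \<Longrightarrow> cover (sum_mset (image_mset p (mset_set I))) t = (\<Sum>i\<in>I. cover (p i) t)"
  by (induction I rule: finite_induct) auto

section \<open>Simulation of the game by protocols\<close>

definition layout :: "atom multiset multiset \<Rightarrow> bool" where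
  "layout S \<longleftrightarrow> (\<forall>p\<in>#S. \<forall>a\<in>#p. proper_atom a) \<and>
     (\<forall>t. cover (sum_mset S) t = (if 0 < t \<and> t \<le> 1 then 1 else 0))"

definition consistent :: "nat \<Rightarrow> (nat \<Rightarrow> real set \<Rightarrow> real) \<Rightarrow> atom multiset multiset \<Rightarrow> bool" where
  "consistent n v S \<longleftrightarrow> (\<forall>p\<in>#S. \<forall>a\<in>#p. true_atom n v a)"

text \<open>\<open>P\<close> is chosen from the recorded atoms alone and must serve every
  \<open>v\<close> that agrees with them. This order of quantifiers lets query trees be assembled by
  induction on the game.\<close>

definition solves :: "nat \<Rightarrow> (nat \<Rightarrow> nat \<Rightarrow> bool) \<Rightarrow> nat \<Rightarrow> atom multiset multiset \<Rightarrow> protocol \<Rightarrow> bool" where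
  "solves n E c S P \<longleftrightarrow> (\<forall>v A q. (\<forall>i<n. valuation (v i)) \<longrightarrow> consistent n v S \<longrightarrow> runs v P A q \<longrightarrow>
     allocation n A \<and> locally_envy_free n E v A \<and> q \<le> c)"

lemma solves_output:
  assumes S: "layout S" and Y: "image_mset value_of S = image_mset Y (mset_set {..<n})"
    and E: "\<And>i j. i < n \<Longrightarrow> j < n \<Longrightarrow> E i j \<Longrightarrow> Y j i \<le> Y i i" and n: "n \<ge> 1"
  shows "\<exists>P. solves n E c S P"
proof -
  obtain p where p: "S = image_mset p (mset_set {..<n})" and pY: "\<forall>i\<in>{..<n}. value_of (p i) = Y i"
    using image_mset_eq_indexed[OF finite_lessThan Y] by blast
  \<comment> \<open>The left-open atoms miss the point 0; agent 0 receives it, and it is worth 0 to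
    everybody.\<close>
  define A where "A i = region (p i) \<union> (if i = 0 then {0} else {})" for i
  have cov: "(\<Sum>i<n. cover (p i) t) = (if 0 < t \<and> t \<le> 1 then 1 else 0)" for t
    using S by (simp add: layout_def p cover_sum_mset)
  have proper: "\<forall>a\<in>#p i. proper_atom a" if "i < n" for i using S that by (simp add: layout_def p)
  have cov1: "cover (p i) t \<le> (if 0 < t \<and> t \<le> 1 then 1 else 0)" if "i < n" for i t
    unfolding cov[symmetric] using that by (intro member_le_sum) auto
  have reg01: "region (p i) \<subseteq> {0<..1}" if "i < n" for i
    using cov1[OF that] by (force simp: region_cover split: if_splits)
  have p0: "piece {0}" by (intro piece_interval) (auto simp: is_interval_1)
  have pieceA: "piece (A i)" if "i < n" for i
    using piece_Un[OF region_piece[OF proper[OF that]] p0] region_piece[OF proper[OF that]]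
    by (cases "i = 0") (auto simp: A_def)
  have "allocation n A"
    unfolding allocation_def
  proof (intro conjI allI impI)
    fix i j assume ij: "i < n" "j < n" "i \<noteq> j"
    have "region (p i) \<inter> region (p j) = {}"
    proof (rule ccontr)
      assume "\<not> ?thesis"
      then obtain t where t: "cover (p i) t > 0" "cover (p j) t > 0" by (auto simp: region_cover)
      have "(\<Sum>k\<in>{i, j}. cover (p k) t) \<le> (\<Sum>k<n. cover (p k) t)"
        using ij by (intro sum_mono2) auto
      then show False using t ij cov[of t] by (auto split: if_splits)
    qed
    then show "A i \<inter> A j = {}" using reg01[OF ij(1)] reg01[OF ij(2)] ij(3) by (auto simp: A_def)
  next
    have "t \<in> (\<Union>i<n. region (p i))" if "0 < t" "t \<le> 1" for t
    proof (rule ccontr)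
      assume "\<not> ?thesis"
      then have "(\<Sum>k<n. cover (p k) t) = 0" by (auto simp: region_cover)
      then show False using cov[of t] that by simp
    qed
    then have "{0<..1} \<subseteq> (\<Union>i<n. region (p i))" by auto
    moreover have "(\<Union>i<n. region (p i)) \<subseteq> {0<..1}" using reg01 by auto
    moreover have "(\<Union>i<n. A i) = (\<Union>i<n. region (p i)) \<union> {0}"
    proof -
      have "0 \<in> A 0" "0 < n" using n by (auto simp: A_def)
      then have "0 \<in> (\<Union>i<n. A i)" by blast
      moreover have "region (p i) \<subseteq> A i" "A i \<subseteq> region (p i) \<union> {0}" for i by (auto simp: A_def)
      ultimately show ?thesis by blast
    qed
    moreover have "{0<..1} \<union> {0} = {0..1::real}" by auto
    ultimately show "(\<Union>i<n. A i) = {0..1}" by (metis subset_antisym)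
  qed (use pieceA in auto)
  moreover have "locally_envy_free n E v A" if v: "\<forall>i<n. valuation (v i)" "consistent n v S" for v
  proof -
    have "v i (A j) = Y j i" if ij: "i < n" "j < n" for i j
    proof -
      have vi: "valuation (v i)" using v ij by simp
      have "v i (region (p j)) = value_of (p j) i"
      proof (rule region_value[of v i, OF vi ij(1) proper[OF ij(2)]])
        show "\<forall>a\<in>#p j. true_atom n v a" using v(2) ij(2) by (simp add: consistent_def p)
        show "cover (p j) t \<le> 1" for t using cov1[OF ij(2), of t] by (auto split: if_splits)
      qed
      moreover have "v i (region (p j) \<union> {0}) = v i (region (p j)) + v i {0}"
        using reg01[OF ij(2)] by (intro valuation_Un vi region_piece[OF proper[OF ij(2)]] p0) auto
      ultimately show ?thesis using valuation_point[OF vi, of 0] pY ij by (auto simp: A_def)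
    qed
    then show ?thesis using E by (simp add: locally_envy_free_def)
  qed
  ultimately have "solves n E c S (Output A)"
    unfolding solves_def by (auto elim!: runs_OutputE)
  then show ?thesis ..
qed

text \<open>As \<open>t\<close> is attainable within the atom, the oracle cannot answer arbitrarily.
  It may still answer beyond \<open>u\<close>, but then the part between \<open>u\<close> and
  \<open>y\<close> is worthless, and \<open>min y u\<close> is correct as well.\<close>

lemma cut_answer_atom:
  assumes v: "valuation w" and lu: "0 \<le> l" "l \<le> u" "u \<le> 1" and t: "0 \<le> t" "t \<le> w {l..u}"
    and c: "cut_answer w l t y"
  shows "l \<le> min y u" "w {l..min y u} = t"
proof -
  have "\<exists>lam. 0 \<le> lam \<and> lam \<le> 1 \<and> lam * w {l..u} = t"
  proof (cases "w {l..u} = 0")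
    case True
    then show ?thesis using t by (intro exI[of _ 0]) auto
  next
    case False
    then show ?thesis using t by (intro exI[of _ "t / w {l..u}"]) auto
  qed
  then obtain lam where lam: "0 \<le> lam" "lam \<le> 1" "lam * w {l..u} = t" by blast
  have "\<exists>y'. l \<le> y' \<and> y' \<le> u \<and> w {l..y'} = lam * w {l..u}"
    using v lu lam unfolding valuation_def by blast
  then obtain y' where "l \<le> y'" "y' \<le> 1" "w {l..y'} = t" using lam lu by auto
  then have y: "l \<le> y" "y \<le> 1" "w {l..y} = t" using c unfolding cut_answer_def by blast+
  show "l \<le> min y u" using y lu by simp
  show "w {l..min y u} = t"
  proof (cases "y \<le> u")
    case True
    then show ?thesis using y by simp
  next
    case False
    have "0 \<le> w {u<..y}" using y lu by (intro nonneg_valuation v piece_interval) auto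
    moreover have "w {l<..y} = w {l<..u} + w {u<..y}" using False y lu by (intro valuation_split v) auto
    ultimately have "w {l..u} \<le> t" using y lu False by (simp add: valuation_ioc[OF v])
    then show ?thesis using t False by simp
  qed
qed

text \<open>A split is one cut query followed by \<open>n\<close> evaluations, so all values of all atoms stay known.\<close>

lemma can_solves:
  assumes "can_reach n G k M" "n \<ge> 1"
    and G: "\<And>M. G M \<Longrightarrow> \<exists>Y. M = image_mset Y (mset_set {..<n}) \<and> (\<forall>i<n. \<forall>j<n. E i j \<longrightarrow> Y j i \<le> Y i i)"
    and "layout S" "image_mset value_of S = M"
  shows "\<exists>P. solves n E (k * (n + 1)) S P"
  using assms(1,4,5)
proof (induction arbitrary: S rule: can_reach.induct)
  case (stop M k)
  from G[OF stop(1)] obtain Y where "M = image_mset Y (mset_set {..<n})"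
    "\<forall>i<n. \<forall>j<n. E i j \<longrightarrow> Y j i \<le> Y i i" by blast
  then show ?case using stop assms(2) by (intro solves_output[of S Y]) auto
next
  case (merge k M u w)
  from merge.prems(2) have "image_mset value_of S = add_mset w (add_mset u M)" by simp
  from msed_map_invR[OF this] obtain S1 q where q: "S = add_mset q S1" "value_of q = w"
    "image_mset value_of S1 = add_mset u M" by (metis add_mset_add_single)
  from msed_map_invR[OF q(3)] obtain S0 p where p: "S1 = add_mset p S0" "value_of p = u"
    "image_mset value_of S0 = M" by (metis add_mset_add_single)
  \<comment> \<open>Merging unites two multisets of atoms: no query is asked and the recorded facts
    stay the same.\<close>
  have "\<exists>P. solves n E (k * (n + 1)) (add_mset (p + q) S0) P"
  proof (rule merge.IH)
    show "layout (add_mset (p + q) S0)"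
      using merge.prems(1) by (auto simp: layout_def q p ac_simps)
  qed (use q p in simp)
  moreover have "consistent n v (add_mset (p + q) S0) \<longleftrightarrow> consistent n v S" for v
    by (auto simp: consistent_def q p)
  ultimately show ?case by (simp add: solves_def)
next
  case (split i t x k M)
  from split.prems(2) have "image_mset value_of S = add_mset x M" by simp
  from msed_map_invR[OF this] obtain S0 p where S: "S = add_mset p S0" and px: "value_of p = x"
    and S0: "image_mset value_of S0 = M" by (metis add_mset_add_single)
  show ?case
  proof (cases "p = {#}")
    \<comment> \<open>An empty piece has value 0 and is split into two empty ones without a
      query.\<close>
    case True
    then have x: "x = 0" "t = 0" using px split.hyps by (auto simp: zero_fun_apply)
    have "\<exists>P. solves n E (k * (n + 1)) (S0 + {#{#}#} + {#{#}#}) P"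
      by (rule split.IH[of 0 0]) (use split.prems(1) S True S0 x in \<open>auto simp: layout_def zero_fun_apply\<close>)
    then show ?thesis using S True by (fastforce simp: solves_def consistent_def)
  next
    case False
    have proper: "\<forall>a\<in>#p. proper_atom a" using split.prems(1) S by (simp add: layout_def)
    obtain p1 l u a p2 where p: "p = p1 + {#(l, u, a)#} + p2" and
      t1: "value_of p1 i \<le> t" "t \<le> value_of p1 i + a i"
      using split_position[OF proper split.hyps(2) _ False] split.hyps(3) px by blast
    have lu: "0 \<le> l" "l \<le> u" "u \<le> 1" "0 \<le> a" using proper by (auto simp: p proper_atom_def)
    have val0: "0 \<le> value_of r" if "\<forall>a\<in>#r. proper_atom a" for r
      using that by (induction r) (auto simp: proper_atom_def le_fun_def plus_fun_apply zero_fun_apply)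
    \<comment> \<open>The layout after cutting the atom at \<open>y\<close>, where \<open>b\<close>
      holds the values of its left part. The right part is known by subtraction, so evaluating one
      side is enough.\<close>
    define T where "T y b = S0 + {#p1 + {#(l, y, b)#}#} + {#{#(y, u, \<lambda>j. a j - b j)#} + p2#}" for y and b :: profile
    have "\<exists>P. solves n E (k * (n + 1)) (T y b) P"
      if y: "l \<le> y" "y \<le> u" and b: "0 \<le> b" "b \<le> a" "b i = t - value_of p1 i" for y b
    proof (rule split.IH)
      show "0 \<le> value_of p1 + b" "0 \<le> (\<lambda>j. a j - b j) + value_of p2"
        using val0[of p1] val0[of p2] proper b
        by (auto simp: p le_fun_def plus_fun_apply zero_fun_apply)
      show "value_of p1 + b + ((\<lambda>j. a j - b j) + value_of p2) = x"
        by (auto simp: px[symmetric] p plus_fun_apply fun_eq_iff)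
      show "(value_of p1 + b) i = t" using b by (simp add: plus_fun_apply)
      show "layout (T y b)"
        using split.prems(1) y b lu proper
        by (auto simp: layout_def T_def S p proper_atom_def le_fun_def zero_fun_apply split: if_splits)
      show "image_mset value_of (T y b) = M + {#value_of p1 + b#} + {#(\<lambda>j. a j - b j) + value_of p2#}"
        using S0 by (simp add: T_def ac_simps)
    qed
    \<comment> \<open>One continuation for every possible position and answer, chosen before any
      valuation is fixed.\<close>
    then obtain Q where Q: "\<And>y b. l \<le> y \<Longrightarrow> y \<le> u \<Longrightarrow> 0 \<le> b \<Longrightarrow> b \<le> a \<Longrightarrow> b i = t - value_of p1 i \<Longrightarrow>
      solves n E (k * (n + 1)) (T y b) (Q y b)"
      by metis
    have "solves n E (Suc k * (n + 1)) S
      (Cut i l (t - value_of p1 i) (\<lambda>y. eval_all n l (min y u) (\<lambda>b. Q (min y u) b)))"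
      unfolding solves_def
    proof (intro allI impI)
      fix v A q
      assume v: "\<forall>i<n. valuation (v i)" and cons: "consistent n v S"
        and run: "runs v (Cut i l (t - value_of p1 i) (\<lambda>y. eval_all n l (min y u) (\<lambda>b. Q (min y u) b))) A q"
      from run obtain y0 q1 where y0: "cut_answer (v i) l (t - value_of p1 i) y0"
        and q1: "q = Suc q1" "runs v (eval_all n l (min y0 u) (\<lambda>b. Q (min y0 u) b)) A q1"
        by (auto elim: runs_CutE)
      define y where "y = min y0 u"
      define b where "b = (\<lambda>j. if j < n then v j {l..y} else 0)"
      obtain q2 where q2: "q1 = q2 + n" "runs v (Q y b) A q2"
        using runs_eval_all[OF q1(2)] unfolding y_def b_def by blast
      have av: "v j {l<..u} = a j" if "j < n" for j
        using cons that by (simp add: consistent_def S p true_atom_def)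
      have cut: "l \<le> y" "v i {l..y} = t - value_of p1 i"
        unfolding y_def using cut_answer_atom[OF _ lu(1-3) _ _ y0] v split.hyps(1) t1 av[OF split.hyps(1)]
          valuation_ioc[of "v i" l u] lu by auto
      have yu: "y \<le> u" by (simp add: y_def)
      have ioc: "v j {l<..y} = v j {l..y}" if "j < n" for j
        using v that lu cut yu by (intro valuation_ioc) auto
      have spl: "v j {y<..u} = a j - v j {l..y}" if "j < n" for j
        using valuation_split[of "v j" l y u] v that lu cut yu av[OF that] ioc[OF that] by simp
      have pos: "0 \<le> v j {l<..y}" "0 \<le> v j {y<..u}" if "j < n" for j
        using v that lu cut yu by (auto intro!: nonneg_valuation piece_interval)
      have "0 \<le> b" "b \<le> a"
        using pos lu(4) by (auto simp: b_def le_fun_def zero_fun_apply ioc spl)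
      moreover have "b i = t - value_of p1 i" using cut split.hyps(1) by (simp add: b_def)
      ultimately have "solves n E (k * (n + 1)) (T y b) (Q y b)" using cut yu by (intro Q)
      moreover have "consistent n v (T y b)"
        using cons by (auto simp: consistent_def S p T_def true_atom_def b_def ioc spl)
      ultimately have "allocation n A \<and> locally_envy_free n E v A \<and> q2 \<le> k * (n + 1)"
        using v q2 unfolding solves_def by blast
      then show "allocation n A \<and> locally_envy_free n E v A \<and> q \<le> Suc k * (n + 1)"
        using q1 q2 by simp
    qed
    then show ?thesis by blast
  qed
qed

section \<open>The query bound and its exponent\<close>

definition splits :: "nat \<Rightarrow> nat" where
  "splits n = n * (n + n * nat \<lceil>ln (real n)\<rceil> + 2) ^ n"

text \<open>The exponent for which the claimed bound equals \<open>splits n * (n + 1)\<close>, as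
  every split costs \<open>n + 1\<close> queries. For \<open>n \<le> 1\<close> the logarithm has a
  degenerate base and the value is set to 0.\<close>

definition excess :: "nat \<Rightarrow> real" where
  "excess n = (if n \<le> 1 then 0 else log n (real (splits n * (n + 1))) / n - 1)"

lemma powr_excess: "n \<ge> 2 \<Longrightarrow> real n powr ((1 + excess n) * real n) = real (splits n * (n + 1))"
  by (simp add: excess_def splits_def del: of_nat_mult of_nat_add of_nat_power)

text \<open>The logarithm of the bound is \<open>n * ln m\<close> plus terms of order
  \<open>ln n\<close>, where \<open>m\<close> is of order \<open>n * ln n\<close>; divided by
  \<open>n * ln n\<close> it tends to 1. Replacing the ceiling by \<open>ln n + 1\<close> gives a
  closed upper bound \<open>?g\<close>, and \<open>n \<le> m\<close> gives the lower bound
  0.\<close>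

lemma excess_tendsto: "excess \<longlonglongrightarrow> 0"
proof (rule tendsto_sandwich)
  let ?g = "\<lambda>n::nat. (ln (real n) + real n * ln (n + n * (ln n + 1) + 2) + ln (real n + 1)) / (n * ln n) - 1"
  show "(\<lambda>_. 0::real) \<longlonglongrightarrow> 0" by simp
  show "?g \<longlonglongrightarrow> 0" by real_asymp
  have "0 \<le> excess n \<and> excess n \<le> ?g n" if n: "n \<ge> 2" for n
  proof -
    define m where "m = real n + real n * real (nat \<lceil>ln (real n)\<rceil>) + 2"
    have lnn: "0 < ln (real n)" using n by simp
    have "0 \<le> real n * real (nat \<lceil>ln (real n)\<rceil>)" by (intro mult_nonneg_nonneg of_nat_0_le_iff)
    then have m: "real n \<le> m" "0 < m" unfolding m_def by linarith+
    have "real (nat \<lceil>ln (real n)\<rceil>) \<le> ln n + 1" using lnn by linarith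
    from mult_left_mono[OF this of_nat_0_le_iff[of n]]
    have m2: "m \<le> n + n * (ln n + 1) + 2" unfolding m_def by linarith
    have c: "ln (real (splits n * (n + 1))) = ln n + n * ln m + ln (real n + 1)"
    proof -
      have "real (splits n * (n + 1)) = n * m ^ n * (real n + 1)"
        by (simp add: splits_def m_def algebra_simps)
      then show ?thesis using n m by (simp add: ln_mult ln_realpow)
    qed
    have ex: "excess n = (ln n + n * ln m + ln (real n + 1)) / (n * ln n) - 1"
      using n lnn by (simp only: excess_def log_def c) (simp add: field_simps)
    have "n * ln n \<le> ln n + n * ln m + ln (real n + 1)"
      using m n lnn by (intro order_trans[OF mult_left_mono[of "ln n" "ln m" n]]) auto
    then have "0 \<le> excess n" using lnn n by (simp add: ex le_divide_eq)
    moreover have "ln m \<le> ln (n + n * (ln n + 1) + 2)" using m2 m by simp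
    then have "excess n \<le> ?g n" unfolding ex using lnn n
      by (intro diff_right_mono divide_right_mono add_mono mult_left_mono) auto
    ultimately show ?thesis by simp
  qed
  then show "eventually (\<lambda>n. 0 \<le> excess n) sequentially" "eventually (\<lambda>n. excess n \<le> ?g n) sequentially"
    by (auto intro!: eventually_sequentiallyI[of 2])
qed

lemma sum_single_mset: "finite V \<Longrightarrow> (\<Sum>y\<in>V. {#f y#}) = image_mset f (mset_set V)"
  by (induction V rule: finite_induct) auto

lemma tree_protocol:
  assumes "is_tree n E"
  shows "\<exists>P. \<forall>v. (\<forall>i<n. valuation (v i)) \<longrightarrow> (\<forall>A q. runs v P A q \<longrightarrow>
     allocation n A \<and> locally_envy_free n E v A \<and> q \<le> splits n * (n + 1))"
proof -
  have n: "n \<ge> 1" using assms by (simp add: is_tree_def)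
  \<comment> \<open>By normalization the whole cake is worth 1 to each agent, so the initial atom is
    known without a query.\<close>
  let ?S = "{#{#(0, 1, \<lambda>_. 1)#}#} :: atom multiset multiset"
  \<comment> \<open>With all weights 1 each agent owns one part, the total weight is
    \<open>n\<close>, and \<open>good\<close> becomes local envy-freeness.\<close>
  have "divides_into n (splits n) {..<n} {(i, j). E i j} (\<lambda>_. 1)"
    using tree_divides_into[OF is_tree_tree_graph[OF assms], of n "\<lambda>_. 1"] by (simp add: splits_def)
  then have can_reach: "can_reach n (\<lambda>M. \<exists>Y. M = (\<Sum>y\<in>{..<n}. mset (Y y)) \<and> (\<forall>y\<in>{..<n}. length (Y y) = 1) \<and>
      good {..<n} {(i, j). E i j} Y) (splits n) {#\<lambda>_. 1#}" (is "can_reach n ?G _ _")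
    unfolding divides_into_def by (auto simp: le_fun_def zero_fun_apply)
  have "\<exists>P. solves n E (splits n * (n + 1)) ?S P"
  proof (rule can_solves[OF can_reach n])
    fix M assume "?G M"
    then obtain Y :: "nat \<Rightarrow> profile list" where Y: "M = (\<Sum>y<n. mset (Y y))" "\<And>y. y < n \<Longrightarrow> length (Y y) = 1"
      "good {..<n} {(i, j). E i j} Y" by auto
    have single: "Y y = [hd (Y y)]" if "y < n" for y using Y(2)[OF that] by (cases "Y y") auto
    have "M = (\<Sum>y<n. {#hd (Y y)#})"
      unfolding Y(1) by (intro sum.cong refl) (metis lessThan_iff mset_single_iff_right single)
    then have "M = image_mset (\<lambda>y. hd (Y y)) (mset_set {..<n})" by (simp add: sum_single_mset)
    moreover have "hd (Y j) i \<le> hd (Y i) i" if "i < n" "j < n" "E i j" for i j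
    proof -
      have "hd (Y i) \<in> set (Y i)" "hd (Y j) \<in> set (Y j)" using single that by (metis list.set_intros(1))+
      then show ?thesis using Y(3) that(3) unfolding good_def by blast
    qed
    ultimately show "\<exists>Y. M = image_mset Y (mset_set {..<n}) \<and> (\<forall>i<n. \<forall>j<n. E i j \<longrightarrow> Y j i \<le> Y i i)"
      by blast
  next
    show "layout ?S" by (auto simp: layout_def proper_atom_def le_fun_def zero_fun_apply)
    show "image_mset value_of ?S = {#\<lambda>_. 1#}" by simp
  qed
  then obtain P where P: "solves n E (splits n * (n + 1)) ?S P" ..
  have "consistent n v ?S" if "\<forall>i<n. valuation (v i)" for v
    using that by (auto simp: consistent_def true_atom_def valuation_ioc) (simp add: valuation_def)
  then show ?thesis using P unfolding solves_def by blast
qed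

theorem theorem2:
  shows "\<exists>f :: nat \<Rightarrow> real. f \<longlonglongrightarrow> 0 \<and>
    (\<forall>n E. is_tree n E \<longrightarrow>
      (\<exists>P :: protocol. \<forall>v. (\<forall>i<n. valuation (v i)) \<longrightarrow>
         (\<forall>A q. runs v P A q \<longrightarrow>
            allocation n A \<and> locally_envy_free n E v A \<and>
            real q \<le> real n powr ((1 + f n) * real n))))"
proof (intro exI[of _ excess] conjI allI impI excess_tendsto)
  fix n E assume tree: "is_tree n E"
  then have "n = 1 \<or> n \<ge> 2" by (auto simp: is_tree_def)
  then show "\<exists>P :: protocol. \<forall>v. (\<forall>i<n. valuation (v i)) \<longrightarrow>
         (\<forall>A q. runs v P A q \<longrightarrow>
            allocation n A \<and> locally_envy_free n E v A \<and>
            real q \<le> real n powr ((1 + excess n) * real n))"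
  proof
    assume n: "n = 1"
    \<comment> \<open>For one agent the claimed bound is 1, below the general
      \<open>splits 1 * 2\<close>, so the whole cake is handed out without a query.\<close>
    have "piece {0..1}" by (rule piece_interval) (auto simp: is_interval_1)
    then have "allocation n (\<lambda>_. {0..1})" by (auto simp: allocation_def n)
    moreover have "locally_envy_free n E v A" for v A by (simp add: locally_envy_free_def n)
    ultimately show ?thesis
      by (intro exI[of _ "Output (\<lambda>_. {0..1})"]) (auto elim!: runs_OutputE simp: n)
  next
    assume n: "n \<ge> 2"
    obtain P where "\<forall>v. (\<forall>i<n. valuation (v i)) \<longrightarrow> (\<forall>A q. runs v P A q \<longrightarrow>
       allocation n A \<and> locally_envy_free n E v A \<and> q \<le> splits n * (n + 1))"
      using tree_protocol[OF tree] by blast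
    then show ?thesis by (intro exI[of _ P]) (simp only: powr_excess[OF n] of_nat_le_iff)
  qed
qed

end
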